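(* Let $\mathbb{K}$ be a field of characteristic $0$. Any $n$-dimensional nilpotent Lie algebra over $\mathbb{K}$ with breadth equal to $2$ and characteristic sequence $(2,2,1,\dots,1)$ is isomorphic to a Lie algebra belonging to one of the two families $\mathcal{C}_1(\mathcal{F}^{n,2}_{2,n-2})$ or $\mathcal{C}_2(\mathcal{F}^{n,2}_{2,n-2})$.
   Context: Breadth: $b(\mathfrak{g})=\max\{\operatorname{rank}(\operatorname{ad} X)\;:\; X\in\mathfrak{g}\}$. Characteristic sequence: let $\mathfrak{g}$ be a finite-dimensional nilpotent Lie algebra and $\mathcal{C}^1(\mathfrak{g})=[\mathfrak{g},\mathfrak{g}]$ its derived subalgebra. For $X\in\mathfrak{g}$ let $c(X)$ be the sequence, in decreasing order, of the dimensions of the Jordan blocks of the nilpotent operator $\operatorname{ad}X$. Then $c(\mathfrak{g})=\max\{c(X): X\in\mathfrak{g}\setminus\mathcal{C}^1(\mathfrak{g})\}$, the maximum being taken for the lexicographic order. $\mathcal{F}^{n,2}_{2,n-2}$ denotes the set of $n$-dimensional $2$-step nilpotent Lie algebras over $\mathbb{K}$ with characteristic sequence $(2,2,1,\dots,1)$ (so $n\ge 5$). Let $\{X_1,\dots,X_n\}$ be a basis of $\mathbb{K}^n$ and let $\mu_0$ be the Lie bracket on $\mathbb{K}^n$ given by $\mu_0(X_1,X_2)=X_3$, $\mu_0(X_1,X_4)=X_5$, all other brackets of basis vectors (not obtained by skew-symmetry) being zero. $\mathcal{C}_1(\mathcal{F}^{n,2}_{2,n-2})$ is the family of Lie algebras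 in $\mathcal{F}^{n,2}_{2,n-2}$ corresponding, up to isomorphism, to the brackets $\mu_0+\varphi$, where $\varphi$ is a skew-symmetric bilinear map of the form $$\varphi(X_i,X_j)=a_{i,j}^{3}X_3+a_{i,j}^{5}X_5,\qquad 2\le i<j\le n,\ \ i,j\notin\{3,5\},$$ with $a_{i,j}^{3},a_{i,j}^{5}\in\mathbb{K}$. $\mathcal{C}_2(\mathcal{F}^{n,2}_{2,n-2})$ is the family of Lie algebras in $\mathcal{F}^{n,2}_{2,n-2}$ corresponding, up to isomorphism, to the brackets $\mu_0+\varphi$, where $\varphi$ is a skew-symmetric bilinear map of the form $$\varphi(X_2,X_4)=X_n,\qquad \varphi(X_i,X_j)=a_{i,j}^{3}X_3+a_{i,j}^{5}X_5,\quad 2\le i<j\le n-1,\ (i,j)\ne(2,4),\ i,j\notin\{3,5\},$$ with $a_{i,j}^{3},a_{i,j}^{5}\in\mathbb{K}$. In both cases the products $\varphi(X_i,X_j)$ that are not listed are zero or obtained by skew-symmetry. *)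

theory Defs
  imports
    "HOL-Analysis.Analysis"
    "HOL-Library.List_Lexorder"
    "Jordan_Normal_Form.Jordan_Normal_Form"
begin

text \<open>A copy of \<^locale>\<open>vector_space\<close>: definitions made in the original would also be instantiated
  for, and clash with, its existing global interpretations.\<close>

locale linear_space = vector_space scale
  for scale :: "'a::field \<Rightarrow> 'b::ab_group_add \<Rightarrow> 'b"
begin

definition ordered_basis :: "'b list \<Rightarrow> bool" where
  "ordered_basis bs \<longleftrightarrow> distinct bs \<and> independent (set bs) \<and> span (set bs) = UNIV"

text \<open>Column \<open>j\<close> holds the coordinates of the image of the \<open>j\<close>-th basis vector.\<close>

definition matrix_of :: "'b list \<Rightarrow> ('b \<Rightarrow> 'b) \<Rightarrow> 'a mat" where
  "matrix_of bs f =
     mat (length bs) (length bs) (\<lambda>(i, j). representation (set bs) (f (bs ! j)) (bs ! i))"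

text \<open>For nilpotent operators only: every Jordan block is required to have eigenvalue 0.\<close>

definition nilpotent_jordan_sizes :: "('b \<Rightarrow> 'b) \<Rightarrow> nat list \<Rightarrow> bool" where
  "nilpotent_jordan_sizes f ns \<longleftrightarrow>
     sorted_wrt (\<ge>) ns \<and>
     (\<exists>bs. ordered_basis bs \<and> jordan_nf (matrix_of bs f) (map (\<lambda>k. (k, 0)) ns))"

definition skew_bilinear :: "('b \<Rightarrow> 'b \<Rightarrow> 'b) \<Rightarrow> bool" where
  "skew_bilinear \<beta> \<longleftrightarrow>
     (\<forall>x. Vector_Spaces.linear scale scale (\<beta> x)) \<and> (\<forall>x y. \<beta> y x = - \<beta> x y)"

text \<open>The basis vectors are \<open>X 1, \<dots>, X n\<close>; other values of \<open>X\<close> are irrelevant.\<close>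

definition indexed_basis :: "nat \<Rightarrow> (nat \<Rightarrow> 'b) \<Rightarrow> bool" where
  "indexed_basis n X \<longleftrightarrow>
     inj_on X {1..n} \<and> independent (X ` {1..n}) \<and> span (X ` {1..n}) = UNIV"

text \<open>If \<open>X\<close> is a basis, this determines \<open>\<beta>\<close> uniquely.\<close>

definition skew_with_products ::
    "nat \<Rightarrow> (nat \<Rightarrow> 'b) \<Rightarrow> (nat \<Rightarrow> nat \<Rightarrow> 'b) \<Rightarrow> ('b \<Rightarrow> 'b \<Rightarrow> 'b) \<Rightarrow> bool" where
  "skew_with_products n X t \<beta> \<longleftrightarrow>
     skew_bilinear \<beta> \<and> (\<forall>i j. 1 \<le> i \<and> i < j \<and> j \<le> n \<longrightarrow> \<beta> (X i) (X j) = t i j)"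

definition is_mu0 :: "nat \<Rightarrow> (nat \<Rightarrow> 'b) \<Rightarrow> ('b \<Rightarrow> 'b \<Rightarrow> 'b) \<Rightarrow> bool" where
  "is_mu0 n X = skew_with_products n X
     (\<lambda>i j. if (i, j) = (1, 2) then X 3 else if (i, j) = (1, 4) then X 5 else 0)"

definition is_phi1 :: "nat \<Rightarrow> (nat \<Rightarrow> 'b) \<Rightarrow> ('b \<Rightarrow> 'b \<Rightarrow> 'b) \<Rightarrow> bool" where
  "is_phi1 n X \<phi> \<longleftrightarrow> (\<exists>a3 a5 :: nat \<Rightarrow> nat \<Rightarrow> 'a. skew_with_products n X
     (\<lambda>i j. if 2 \<le> i \<and> i \<notin> {3, 5} \<and> j \<notin> {3, 5}
        then scale (a3 i j) (X 3) + scale (a5 i j) (X 5) else 0) \<phi>)"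

definition is_phi2 :: "nat \<Rightarrow> (nat \<Rightarrow> 'b) \<Rightarrow> ('b \<Rightarrow> 'b \<Rightarrow> 'b) \<Rightarrow> bool" where
  "is_phi2 n X \<phi> \<longleftrightarrow> (\<exists>a3 a5 :: nat \<Rightarrow> nat \<Rightarrow> 'a. skew_with_products n X
     (\<lambda>i j. if (i, j) = (2, 4) then X n
        else if 2 \<le> i \<and> j \<le> n - 1 \<and> i \<notin> {3, 5} \<and> j \<notin> {3, 5}
        then scale (a3 i j) (X 3) + scale (a5 i j) (X 5) else 0) \<phi>)"

end

locale lie_algebra = linear_space scale
  for scale :: "'k::field \<Rightarrow> 'g::ab_group_add \<Rightarrow> 'g" +
  fixes bracket :: "'g \<Rightarrow> 'g \<Rightarrow> 'g"
  assumes linear_left: "Vector_Spaces.linear scale scale (\<lambda>x. bracket x y)"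
    and linear_right: "Vector_Spaces.linear scale scale (\<lambda>y. bracket x y)"
    and alternating: "bracket x x = 0"
    and jacobi: "bracket x (bracket y z) + bracket y (bracket z x) + bracket z (bracket x y) = 0"
begin

abbreviation ad :: "'g \<Rightarrow> 'g \<Rightarrow> 'g" where
  "ad x \<equiv> (\<lambda>y. bracket x y)"

primrec lower_central :: "nat \<Rightarrow> 'g set" where
  "lower_central 0 = UNIV"
| "lower_central (Suc k) = span {bracket x y | x y. x \<in> lower_central k}"

definition nilpotent :: bool where
  "nilpotent \<longleftrightarrow> (\<exists>k. lower_central k = {0})"

definition two_step_nilpotent :: bool where
  "two_step_nilpotent \<longleftrightarrow> lower_central 2 = {0} \<and> lower_central 1 \<noteq> {0}"

definition breadth :: nat where
  "breadth = Max {dim (range (ad x)) | x. True}"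

definition char_seq_at :: "'g \<Rightarrow> nat list" where
  "char_seq_at x = (THE ns. nilpotent_jordan_sizes (ad x) ns)"

text \<open>The order on \<^typ>\<open>nat list\<close> used by \<^const>\<open>Max\<close> is the lexicographic one
  (from \<^theory>\<open>HOL-Library.List_Lexorder\<close>). Meaningful for nonzero finite-dimensional nilpotent
  algebras.\<close>

definition char_seq :: "nat list" where
  "char_seq = Max {char_seq_at x | x. x \<notin> lower_central 1}"

end

definition lie_isomorphic ::
    "('k::field \<Rightarrow> 'g::ab_group_add \<Rightarrow> 'g) \<Rightarrow> ('g \<Rightarrow> 'g \<Rightarrow> 'g) \<Rightarrow>
     ('k \<Rightarrow> 'h::ab_group_add \<Rightarrow> 'h) \<Rightarrow> ('h \<Rightarrow> 'h \<Rightarrow> 'h) \<Rightarrow> bool" where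
  "lie_isomorphic s1 br1 s2 br2 \<longleftrightarrow>
     (\<exists>f. Vector_Spaces.linear s1 s2 f \<and> bij f \<and> (\<forall>x y. f (br1 x y) = br2 (f x) (f y)))"

text \<open>The sequence \<open>(2,2,1,\<dots>,1)\<close> with sum \<open>n\<close>.\<close>

definition seq_22 :: "nat \<Rightarrow> nat list" where
  "seq_22 n = [2, 2] @ replicate (n - 4) 1"

text \<open>The brackets on \<open>\<bbbK>\<^sup>n\<close>, \<open>n = CARD('n)\<close>, whose Lie algebra is 2-step nilpotent with
  characteristic sequence \<open>(2,2,1,\<dots>,1)\<close>; the set is empty unless \<open>n \<ge> 5\<close>.\<close>

definition family_F :: "('k::field ^ 'n \<Rightarrow> 'k ^ 'n \<Rightarrow> 'k ^ 'n) set" where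
  "family_F = {\<mu>. lie_algebra (*s) \<mu> \<and>
     lie_algebra.two_step_nilpotent (*s) \<mu> \<and>
     lie_algebra.char_seq (*s) \<mu> = seq_22 CARD('n)}"

definition family_C1 ::
    "(nat \<Rightarrow> 'k::field ^ 'n) \<Rightarrow> ('k ^ 'n \<Rightarrow> 'k ^ 'n \<Rightarrow> 'k ^ 'n) set" where
  "family_C1 X = {\<mu> \<in> family_F. \<exists>\<mu>0 \<phi>.
     linear_space.is_mu0 (*s) CARD('n) X \<mu>0 \<and> linear_space.is_phi1 (*s) CARD('n) X \<phi> \<and>
     \<mu> = (\<lambda>x y. \<mu>0 x y + \<phi> x y)}"

definition family_C2 ::
    "(nat \<Rightarrow> 'k::field ^ 'n) \<Rightarrow> ('k ^ 'n \<Rightarrow> 'k ^ 'n \<Rightarrow> 'k ^ 'n) set" where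
  "family_C2 X = {\<mu> \<in> family_F. \<exists>\<mu>0 \<phi>.
     linear_space.is_mu0 (*s) CARD('n) X \<mu>0 \<and> linear_space.is_phi2 (*s) CARD('n) X \<phi> \<and>
     \<mu> = (\<lambda>x y. \<mu>0 x y + \<phi> x y)}"

end

theory Submission
  imports Defs
    "HOL-Library.Multiset"
    "Jordan_Normal_Form.Jordan_Normal_Form_Uniqueness"
    "Jordan_Normal_Form.Jordan_Normal_Form_Existence"
begin

text \<open>
  Two facts about \<open>ad\<close> carry the proof.

  First, the characteristic sequence \<open>(2,2,1,\<dots>,1)\<close> makes the algebra 2-step nilpotent. It bounds
  the Jordan blocks of \<open>ad x\<close> by 2 for every \<open>x\<close> outside the derived algebra, so \<open>(ad x)\<^sup>2 = 0\<close> there;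
  expanding \<open>(ad (x + v))\<^sup>2\<close> and \<open>(ad (x - v))\<^sup>2\<close> for one \<open>v\<close> outside the derived algebra gives the same
  for \<open>x\<close> inside. A Lie algebra with \<open>[x, [x, y]] = 0\<close> throughout has a triple product \<open>[x, [y, z]]\<close>
  that is alternating, so that the Jacobi identity says \<open>3 [x, [y, z]] = 0\<close>
  (\<open>ad_square_eq_0_if_char_seq_22\<close>, \<open>class_2_if_ad_square_eq_0\<close>). The maximum that defines the
  characteristic sequence is only informative once every nilpotent operator is known to have exactly
  one descending list of Jordan block sizes, and only finitely many lists are known to occur; this is
  the content of the sections on operators and Jordan blocks.

  Second, breadth 2 confines almost all brackets to a plane. Choose \<open>x1\<close> with \<open>ad x1\<close> of rank 2, with
  image spanned by \<open>x3 = [x1, x2]\<close> and \<open>x5 = [x1, x4]\<close>. All operators \<open>ad x1 + t ad y = ad (x1 + t y)\<close>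
  have rank at most 2, and an operator \<open>D\<close> for which \<open>A + t D\<close> never has larger rank than \<open>A\<close> maps the
  kernel of \<open>A\<close> into the image of \<open>A\<close> (\<open>kernel_mapped_into_range_if_rank_le_2\<close>). Hence \<open>[y, k]\<close> lies in
  the span of \<open>x3\<close> and \<open>x5\<close> whenever \<open>[x1, k] = 0\<close>. As \<open>x2\<close> and \<open>x4\<close> span a complement of the kernel of
  \<open>ad x1\<close>, the only bracket left undecided is \<open>[x2, x4]\<close>. If it lies in the span of \<open>x3\<close> and \<open>x5\<close>, the algebra has
  the form of the first family; if not, \<open>[x2, x4]\<close> is taken as the last basis vector, and the algebra has
  the form of the second (\<open>normal_form_if_class_2_breadth_2\<close>).

  The linear map that sends this adapted basis to the given one of \<open>\<bbbK>\<^sup>n\<close> carries the bracket over. That the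
  image still has the required characteristic sequence follows from the invariance of all notions
  involved under isomorphism.
\<close>

section \<open>Linear operators and their matrices\<close>

context linear_space
begin

lemma sum_representation_nth:
  assumes "ordered_basis bs"
  shows "(\<Sum>i<length bs. scale (representation (set bs) v (bs ! i)) (bs ! i)) = v"
proof -
  have inj: "inj_on ((!) bs) {..<length bs}"
    using assms by (auto simp: ordered_basis_def inj_on_nth)
  have "set bs = (!) bs ` {..<length bs}"
    by (auto simp: set_conv_nth)
  then have "(\<Sum>i<length bs. scale (representation (set bs) v (bs ! i)) (bs ! i)) =
      (\<Sum>b\<in>set bs. scale (representation (set bs) v b) b)"
    using inj by (simp add: sum.reindex)
  also have "\<dots> = v"
    using assms by (intro sum_representation_eq) (auto simp: ordered_basis_def)
  finally show ?thesis .
qed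

text \<open>Allowing different bases for source and target turns change of basis into the special case
  of the identity map, and similarity of matrices into functoriality.\<close>

definition matrix_between :: "'b list \<Rightarrow> 'b list \<Rightarrow> ('b \<Rightarrow> 'b) \<Rightarrow> 'a mat" where
  "matrix_between as bs f =
     mat (length as) (length bs) (\<lambda>(i, j). representation (set as) (f (bs ! j)) (as ! i))"

lemma matrix_of_eq_matrix_between: "matrix_of bs f = matrix_between bs bs f"
  by (simp add: matrix_of_def matrix_between_def)

lemma matrix_between_carrier [simp]:
  "matrix_between as bs f \<in> carrier_mat (length as) (length bs)"
  by (simp add: matrix_between_def)

lemma matrix_between_comp:
  assumes as: "ordered_basis as" and bs: "ordered_basis bs"
    and f: "Vector_Spaces.linear scale scale f"
  shows "matrix_between as bs f * matrix_between bs cs g = matrix_between as cs (f \<circ> g)"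
proof (rule eq_matI)
  fix i j
  assume "i < dim_row (matrix_between as cs (f \<circ> g))" "j < dim_col (matrix_between as cs (f \<circ> g))"
  then have i: "i < length as" and j: "j < length cs"
    by (simp_all add: matrix_between_def)
  interpret f: Vector_Spaces.linear scale scale f by (fact f)
  let ?r = "representation (set bs) (g (cs ! j))"
  have ind: "independent (set as)" and span: "span (set as) = UNIV"
    using as by (auto simp: ordered_basis_def)
  have "f (g (cs ! j)) = f (\<Sum>k<length bs. scale (?r (bs ! k)) (bs ! k))"
    by (simp add: sum_representation_nth [OF bs])
  also have "\<dots> = (\<Sum>k<length bs. scale (?r (bs ! k)) (f (bs ! k)))"
    by (simp add: f.sum f.scale)
  finally have "representation (set as) (f (g (cs ! j))) (as ! i) =
      (\<Sum>k<length bs. ?r (bs ! k) * representation (set as) (f (bs ! k)) (as ! i))"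
    by (simp add: representation_sum [OF ind] representation_scale [OF ind] span)
  then show "(matrix_between as bs f * matrix_between bs cs g) $$ (i, j) =
      matrix_between as cs (f \<circ> g) $$ (i, j)"
    using i j by (simp add: matrix_between_def scalar_prod_def atLeast0LessThan mult.commute)
qed (simp_all add: matrix_between_def)

lemma matrix_between_id:
  assumes "ordered_basis bs"
  shows "matrix_between bs bs id = 1\<^sub>m (length bs)"
  using assms
  by (intro eq_matI)
    (auto simp: matrix_between_def ordered_basis_def representation_basis nth_eq_iff_index_eq)

lemma linear_idI: "Vector_Spaces.linear scale scale id"
  using linear_id by (simp add: id_def)

lemma length_ordered_basis:
  assumes "ordered_basis bs"
  shows "length bs = dim UNIV"
  using assms dim_eq_card [of "set bs" UNIV] by (simp add: ordered_basis_def distinct_card)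

lemma similar_matrix_of:
  assumes as: "ordered_basis as" and bs: "ordered_basis bs"
    and f: "Vector_Spaces.linear scale scale f"
  shows "similar_mat (matrix_of as f) (matrix_of bs f)"
proof (rule similar_matI)
  have len: "length as = length bs"
    using as bs by (simp add: length_ordered_basis)
  note id = linear_idI
  show "{matrix_of as f, matrix_of bs f, matrix_between as bs id, matrix_between bs as id}
      \<subseteq> carrier_mat (length bs) (length bs)"
    using matrix_between_carrier [of as bs id] matrix_between_carrier [of bs as id]
      matrix_between_carrier [of as as f] matrix_between_carrier [of bs bs f]
    by (simp add: len matrix_of_eq_matrix_between)
  show "matrix_between as bs id * matrix_between bs as id = 1\<^sub>m (length bs)"
    using matrix_between_comp [OF as bs id, of as id] matrix_between_id [OF as] by (simp add: len)
  show "matrix_between bs as id * matrix_between as bs id = 1\<^sub>m (length bs)"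
    using matrix_between_comp [OF bs as id, of bs id] matrix_between_id [OF bs] by simp
  show "matrix_of as f = matrix_between as bs id * matrix_of bs f * matrix_between bs as id"
    using matrix_between_comp [OF as bs id, of bs f] matrix_between_comp [OF as bs f, of as id]
    by (simp add: matrix_of_eq_matrix_between)
qed

text \<open>Take a longest independent list of the required kind. If its span \<open>W\<close> missed a vector \<open>v\<close>,
  the last iterate of \<open>v\<close> under \<open>f\<close> outside \<open>W\<close> could be appended, as \<open>f\<close> maps it into \<open>W\<close>. Over an
  arbitrary field this replaces the factorisation of the characteristic polynomial as the
  source of a triangular matrix.\<close>

lemma strictly_triangular_basis:
  assumes fin: "finite B" "span B = UNIV"
    and f: "Vector_Spaces.linear scale scale f"
    and nilp: "\<And>v. (f ^^ m) v = 0"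
  shows "\<exists>bs. ordered_basis bs \<and> (\<forall>i<length bs. f (bs ! i) \<in> span (set (take i bs)))"
proof -
  interpret f: Vector_Spaces.linear scale scale f by (fact f)
  let ?P = "\<lambda>bs. distinct bs \<and> independent (set bs) \<and>
      (\<forall>i<length bs. f (bs ! i) \<in> span (set (take i bs)))"
  have bound: "length bs \<le> card B" if "?P bs" for bs
  proof -
    have "card (set bs) \<le> card B"
      using that fin independent_span_bound [of B "set bs"] by auto
    then show ?thesis using that by (simp add: distinct_card)
  qed
  have "?P []" by (simp add: independent_empty)
  then obtain bs where bs: "?P bs" and max: "\<And>cs. ?P cs \<Longrightarrow> length cs \<le> length bs"
    using bound ex_has_greatest_nat [of ?P "[]" length "card B + 1"] by (metis less_Suc_eq_le Suc_eq_plus1)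
  have "span (set bs) = UNIV"
  proof (rule ccontr)
    assume "span (set bs) \<noteq> UNIV"
    then obtain v where v: "v \<notin> span (set bs)" by auto
    define k where "k = (LEAST k. (f ^^ k) v \<in> span (set bs))"
    have k: "(f ^^ k) v \<in> span (set bs)"
      unfolding k_def by (rule LeastI [of _ m]) (simp add: nilp span_zero)
    with v have "k \<noteq> 0" by (cases k) auto
    then obtain l where l: "k = Suc l" by (cases k) auto
    define w where "w = (f ^^ l) v"
    have w: "w \<notin> span (set bs)"
      using not_less_Least [of l "\<lambda>k. (f ^^ k) v \<in> span (set bs)"] l
      by (simp add: w_def k_def [symmetric])
    have fw: "f w \<in> span (set bs)"
      using k by (simp add: w_def l)
    have "w \<notin> set bs" using w span_base by blast
    then have "?P (bs @ [w])"
      using bs w fw by (auto simp: independent_insertI less_Suc_eq nth_append)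
    from max [OF this] show False by simp
  qed
  with bs show ?thesis by (auto simp: ordered_basis_def)
qed

lemma upper_triangular_matrix_of:
  assumes bs: "ordered_basis bs" and f: "\<And>i. i < length bs \<Longrightarrow> f (bs ! i) \<in> span (set (take i bs))"
  shows "upper_triangular (matrix_of bs f)" "\<And>i. i < length bs \<Longrightarrow> matrix_of bs f $$ (i, i) = 0"
proof -
  have *: "matrix_of bs f $$ (i, j) = 0" if "j \<le> i" "i < length bs" for i j
  proof -
    have ind: "independent (set bs)" and dist: "distinct bs"
      using bs by (auto simp: ordered_basis_def)
    have "representation (set bs) (f (bs ! j)) = representation (set (take j bs)) (f (bs ! j))"
      using f [of j] that by (intro representation_extend ind) (auto simp: set_take_subset)
    moreover have "bs ! i \<notin> set (take j bs)"
      using that dist by (auto simp: in_set_conv_nth nth_eq_iff_index_eq)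
    then have "representation (set (take j bs)) (f (bs ! j)) (bs ! i) = 0"
      using representation_ne_zero by blast
    ultimately show ?thesis using that by (simp add: matrix_of_def)
  qed
  show "upper_triangular (matrix_of bs f)"
    using * by (auto simp: upper_triangular_def matrix_of_def)
  show "matrix_of bs f $$ (i, i) = 0" if "i < length bs" for i
    using * that by simp
qed

end

section \<open>Jordan block sizes of nilpotent operators\<close>

text \<open>The similarity is given by the permutation matrix that exchanges the two blocks.\<close>

lemma similar_mat_swap_blocks:
  fixes A B :: "'a::comm_ring_1 mat"
  assumes A: "A \<in> carrier_mat n n" and B: "B \<in> carrier_mat m m"
  shows "similar_mat (diag_block_mat [A, B]) (diag_block_mat [B, A])"
proof (rule similar_matI)
  let ?P = "four_block_mat (0\<^sub>m n m) (1\<^sub>m n) (1\<^sub>m m) (0\<^sub>m m n) :: 'a mat"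
  let ?Q = "four_block_mat (0\<^sub>m m n) (1\<^sub>m m) (1\<^sub>m n) (0\<^sub>m n m) :: 'a mat"
  have AB: "diag_block_mat [A, B] = four_block_mat A (0\<^sub>m n m) (0\<^sub>m m n) B"
    using A B diag_block_mat.simps(2) [of A "[B]"]
    by (simp add: Let_def del: diag_block_mat.simps)
  have BA: "diag_block_mat [B, A] = four_block_mat B (0\<^sub>m m n) (0\<^sub>m n m) A"
    using A B diag_block_mat.simps(2) [of B "[A]"]
    by (simp add: Let_def del: diag_block_mat.simps)
  note dims = carrier_matD [OF A] carrier_matD [OF B]
  show "{diag_block_mat [A, B], diag_block_mat [B, A], ?P, ?Q} \<subseteq> carrier_mat (n + m) (n + m)"
    unfolding AB BA by (auto intro!: carrier_matI simp: dims)
  note mult = mult_four_block_mat [where ?'a = 'a]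
  note ids = left_mult_zero_mat [OF A] left_mult_zero_mat [OF B] right_mult_zero_mat [OF A]
    right_mult_zero_mat [OF B] left_mult_one_mat [OF A] left_mult_one_mat [OF B]
    right_mult_one_mat [OF A] right_mult_one_mat [OF B] left_add_zero_mat [OF A]
    left_add_zero_mat [OF B] right_add_zero_mat [OF A] right_add_zero_mat [OF B]
  note zo = zero_carrier_mat one_carrier_mat
  show "?P * ?Q = 1\<^sub>m (n + m)"
    by (subst mult [OF zo(1) zo(2) zo(2) zo(1) zo(1) zo(2) zo(2) zo(1)]) simp
  show "?Q * ?P = 1\<^sub>m (n + m)"
    by (subst mult [OF zo(1) zo(2) zo(2) zo(1) zo(1) zo(2) zo(2) zo(1)]) (simp add: add.commute)
  have "?P * diag_block_mat [B, A] = four_block_mat (0\<^sub>m n m) A B (0\<^sub>m m n)"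
    unfolding BA
    by (subst mult [OF zo(1) zo(2) zo(2) zo(1) B zo(1) zo(1) A]) (simp add: ids)
  then show "diag_block_mat [A, B] = ?P * diag_block_mat [B, A] * ?Q"
    unfolding AB
    by (simp only:) (subst mult [OF zo(1) A B zo(1) zo(1) zo(2) zo(2) zo(1)], simp add: ids)
qed

text \<open>Jordan forms are produced with their blocks in some order, whereas block sizes are to be
  listed in decreasing order. Rotating a list is an exchange of two blocks, and this brings
  any entry to the front.\<close>

lemma similar_jordan_matrix_permute:
  fixes xs ys :: "(nat \<times> 'a::comm_ring_1) list"
  assumes "mset xs = mset ys"
  shows "similar_mat (jordan_matrix xs) (jordan_matrix ys)"
  using assms
proof (induction xs arbitrary: ys)
  case Nil
  then show ?case by (auto intro: similar_mat_refl jordan_matrix_carrier)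
next
  case (Cons x xs)
  then have "x \<in> set ys" by (metis list.set_intros(1) mset_eq_setD)
  then obtain us vs where ys: "ys = us @ x # vs" by (auto dest: split_list)
  with Cons.prems have "mset xs = mset (vs @ us)" by simp
  then have IH: "similar_mat (jordan_matrix xs) (jordan_matrix (vs @ us))" by (rule Cons.IH)
  have app: "jordan_matrix (as @ bs) = diag_block_mat [jordan_matrix as, jordan_matrix bs]"
    for as bs :: "(nat \<times> 'a) list"
    using jordan_matrix_concat_diag_block_mat [of "[as, bs]"] by simp
  have "similar_mat (jordan_matrix ([x] @ xs)) (jordan_matrix ([x] @ (vs @ us)))"
    unfolding app
    using IH similar_diag_mat_block_mat
        [of "[(jordan_matrix [x], jordan_matrix [x]), (jordan_matrix xs, jordan_matrix (vs @ us))]"]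
      similar_mat_refl [OF jordan_matrix_carrier, of "[x]"]
    by (auto simp: app)
  moreover have "similar_mat (jordan_matrix ((x # vs) @ us)) (jordan_matrix (us @ (x # vs)))"
    unfolding app by (rule similar_mat_swap_blocks) (rule jordan_matrix_carrier)+
  ultimately show ?case
    unfolding ys by (auto intro: similar_mat_trans)
qed

lemma jordan_matrix_nilpotent:
  assumes "\<forall>k\<in>set ns. k \<le> m"
  shows "jordan_matrix (map (\<lambda>k. (k, 0 :: 'a::field)) ns) ^\<^sub>m m = 0\<^sub>m (sum_list ns) (sum_list ns)"
proof -
  have "diag_block_mat (map (\<lambda>k. jordan_block k (0 :: 'a) ^\<^sub>m m) ns) = 0\<^sub>m (sum_list ns) (sum_list ns)"
    using assms
  proof (induction ns)
    case (Cons k ns)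
    then have "jordan_block k (0 :: 'a) ^\<^sub>m m = 0\<^sub>m k k"
      by (intro eq_matI) (auto simp: jordan_block_zero_pow)
    with Cons show ?case by (simp add: Let_def)
  qed simp
  then show ?thesis by (simp add: jordan_matrix_pow comp_def)
qed

context linear_space
begin

lemma linear_funpow:
  assumes "Vector_Spaces.linear scale scale f"
  shows "Vector_Spaces.linear scale scale (f ^^ k)"
proof (induction k)
  case 0
  then show ?case using linear_idI by (simp add: id_def)
next
  case (Suc k)
  then show ?case using Vector_Spaces.linear_compose [OF Suc assms] by (simp only: funpow.simps)
qed

lemma matrix_of_funpow:
  assumes bs: "ordered_basis bs" and f: "Vector_Spaces.linear scale scale f"
  shows "matrix_of bs f ^\<^sub>m k = matrix_of bs (f ^^ k)"
proof (induction k)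
  case 0
  then show ?case
    using matrix_between_id [OF bs] by (simp add: matrix_of_eq_matrix_between) (simp add: matrix_between_def)
next
  case (Suc k)
  then show ?case
    using matrix_between_comp [OF bs bs linear_funpow [OF f], of k bs f]
    by (simp add: matrix_of_eq_matrix_between funpow_Suc_right comp_def del: funpow.simps)
qed

text \<open>The number of blocks of size \<open>k > 0\<close> is determined by the matrix up to similarity, and
  the ordering then determines the list.\<close>

lemma nilpotent_jordan_sizes_unique:
  assumes f: "Vector_Spaces.linear scale scale f"
    and ns: "nilpotent_jordan_sizes f ns" and ms: "nilpotent_jordan_sizes f ms"
  shows "ns = ms"
proof -
  let ?b = "map (\<lambda>k. (k, 0 :: 'a))"
  obtain as where as: "ordered_basis as" "jordan_nf (matrix_of as f) (?b ns)"
    using ns by (auto simp: nilpotent_jordan_sizes_def)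
  obtain bs where bs: "ordered_basis bs" "jordan_nf (matrix_of bs f) (?b ms)"
    using ms by (auto simp: nilpotent_jordan_sizes_def)
  have "jordan_nf (matrix_of as f) (?b ms)"
    using bs(2) similar_mat_trans [OF similar_matrix_of [OF as(1) bs(1) f], of "jordan_matrix (?b ms)"]
    by (simp add: jordan_nf_def)
  then have count: "length (filter ((=) (k, 0 :: 'a)) (?b ns)) = length (filter ((=) (k, 0)) (?b ms))"
    if "k \<noteq> 0" for k
    using compute_nr_of_jordan_blocks [OF as(2) that, of 0]
      compute_nr_of_jordan_blocks [of "matrix_of as f" "?b ms" k 0] that by simp
  have "0 \<notin> set ns" "0 \<notin> set ms"
    using as(2) bs(2) by (auto simp: jordan_nf_def image_image)
  then have "count (mset ns) k = count (mset ms) k" for k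
  proof (cases "k = 0")
    case False
    then show ?thesis
      using count [of k] by (simp add: count_mset count_list_eq_length_filter filter_map comp_def)
  next
    case True
    then show ?thesis
      using \<open>0 \<notin> set ns\<close> \<open>0 \<notin> set ms\<close> by (metis count_mset_0_iff)
  qed
  then have "mset ns = mset ms" by (rule multiset_eqI)
  moreover have "sorted (rev ns)" "sorted (rev ms)"
    using ns ms by (auto simp: nilpotent_jordan_sizes_def sorted_wrt_rev)
  ultimately have "rev ns = rev ms"
    by (metis mset_rev properties_for_sort)
  then show ?thesis by simp
qed

text \<open>A strictly triangular matrix has a Jordan form, and its characteristic polynomial \<open>X\<^sup>n\<close>
  forces the eigenvalue of every block to be 0.\<close>

lemma nilpotent_jordan_sizes_exists:
  assumes fin: "finite B" "span B = UNIV"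
    and f: "Vector_Spaces.linear scale scale f"
    and nilp: "\<And>v. (f ^^ m) v = 0"
  shows "\<exists>ns. nilpotent_jordan_sizes f ns"
proof -
  obtain bs where bs: "ordered_basis bs" and tri: "\<And>i. i < length bs \<Longrightarrow> f (bs ! i) \<in> span (set (take i bs))"
    using strictly_triangular_basis [OF fin f nilp] by auto
  let ?A = "matrix_of bs f"
  have A: "?A \<in> carrier_mat (length bs) (length bs)" by (simp add: matrix_of_def)
  note ut = upper_triangular_matrix_of [OF bs tri]
  obtain J where J: "jordan_nf ?A J"
    using triangular_to_jnf_vector [OF A ut(1)] by blast
  have "diag_mat ?A = replicate (length bs) 0"
    using A ut(2) by (intro nth_equalityI) (auto simp: diag_mat_def)
  then have char: "char_poly ?A = [:0, 1:] ^ length bs"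
    using char_poly_upper_triangular [OF A ut(1)] by simp
  have zero: "a = 0" if "(k, a) \<in> set J" for k a
  proof -
    have "k \<noteq> 0" using J that by (force simp: jordan_nf_def)
    then have "0 = (\<Prod>(n, c)\<leftarrow>J. (a - c) ^ n)"
      using that by (force simp: prod_list_zero_iff)
    also have "\<dots> = poly (\<Prod>(n, c)\<leftarrow>J. [:- c, 1:] ^ n) a"
      by (simp add: poly_prod_list comp_def case_prod_unfold)
    also have "\<dots> = a ^ length bs"
      by (simp add: jordan_nf_char_poly [OF J, symmetric] char)
    finally show ?thesis by simp
  qed
  let ?ns = "rev (sort (map fst J))"
  have "map (\<lambda>k. (k, 0)) (map fst J) = J"
    using zero by (auto intro!: map_idI)
  then have "mset (map (\<lambda>k. (k, 0 :: 'a)) ?ns) = mset J"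
    by (metis mset_map mset_rev mset_sort)
  then have perm: "mset J = mset (map (\<lambda>k. (k, 0 :: 'a)) ?ns)" by (rule sym)
  have sim: "similar_mat ?A (jordan_matrix J)" and pos: "0 \<notin> fst ` set J"
    using J by (simp_all add: jordan_nf_def)
  have "similar_mat ?A (jordan_matrix (map (\<lambda>k. (k, 0)) ?ns))"
    by (rule similar_mat_trans [OF sim similar_jordan_matrix_permute [OF perm]])
  moreover have "0 \<notin> fst ` set (map (\<lambda>k. (k, 0 :: 'a)) ?ns)"
    using pos unfolding mset_eq_setD [OF perm] .
  ultimately have "jordan_nf ?A (map (\<lambda>k. (k, 0)) ?ns)"
    unfolding jordan_nf_def by blast
  moreover have "sorted_wrt (\<ge>) ?ns" by (simp add: sorted_wrt_rev)
  ultimately show ?thesis using bs by (auto simp: nilpotent_jordan_sizes_def)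
qed

lemma sum_jordan_sizes:
  assumes bs: "ordered_basis bs" and J: "jordan_nf (matrix_of bs f) (map (\<lambda>k. (k, 0)) ns)"
  shows "sum_list ns = length bs"
proof -
  let ?J = "jordan_matrix (map (\<lambda>k. (k, 0 :: 'a)) ns)"
  have "similar_mat (matrix_of bs f) ?J"
    using J by (simp add: jordan_nf_def)
  then obtain n where "matrix_of bs f \<in> carrier_mat n n" "?J \<in> carrier_mat n n"
    using similar_matD by blast
  then have "dim_row (matrix_of bs f) = dim_row ?J" by (metis carrier_matD(1))
  then show ?thesis by (simp add: matrix_of_def comp_def)
qed

text \<open>Only finitely many lists satisfy these bounds; hence maxima over characteristic sequences
  are attained.\<close>

lemma nilpotent_jordan_sizes_bounded:
  assumes "nilpotent_jordan_sizes f ns"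
  shows "set ns \<subseteq> {..dim UNIV}" "length ns \<le> dim UNIV"
proof -
  obtain bs where bs: "ordered_basis bs" and J: "jordan_nf (matrix_of bs f) (map (\<lambda>k. (k, 0)) ns)"
    using assms by (auto simp: nilpotent_jordan_sizes_def)
  have sum: "sum_list ns = dim UNIV"
    using sum_jordan_sizes [OF bs J] length_ordered_basis [OF bs] by simp
  then show "set ns \<subseteq> {..dim UNIV}"
    using member_le_sum_list by fastforce
  have "0 \<notin> set ns" using J by (auto simp: jordan_nf_def image_image)
  then have "length ns \<le> sum_list ns"
    by (induction ns) auto
  with sum show "length ns \<le> dim UNIV" by simp
qed

lemma funpow_eq_0_of_jordan_sizes:
  assumes f: "Vector_Spaces.linear scale scale f"
    and ns: "nilpotent_jordan_sizes f ns" and le: "\<forall>k\<in>set ns. k \<le> m"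
  shows "(f ^^ m) v = 0"
proof -
  obtain bs where bs: "ordered_basis bs" and J: "jordan_nf (matrix_of bs f) (map (\<lambda>k. (k, 0)) ns)"
    using ns by (auto simp: nilpotent_jordan_sizes_def)
  let ?A = "matrix_of bs f" and ?n = "length bs"
  have A: "?A \<in> carrier_mat ?n ?n" by (simp add: matrix_of_def)
  obtain P Q where PQ: "P \<in> carrier_mat ?n ?n" "Q \<in> carrier_mat ?n ?n"
    "\<And>k. ?A ^\<^sub>m k = P * jordan_matrix (map (\<lambda>k. (k, 0)) ns) ^\<^sub>m k * Q"
    using jordan_nf_powE [OF A J] by metis
  have sum: "sum_list ns = ?n" by (rule sum_jordan_sizes [OF bs J])
  have zero: "matrix_of bs (f ^^ m) = 0\<^sub>m ?n ?n"
    using PQ(1,2) unfolding matrix_of_funpow [OF bs f, symmetric] PQ(3) [of m] jordan_matrix_nilpotent [OF le] sum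
    by simp
  have "(f ^^ m) (bs ! j) = 0" if "j < ?n" for j
  proof -
    have "representation (set bs) ((f ^^ m) (bs ! j)) (bs ! i) = 0" if "i < ?n" for i
      using arg_cong [OF zero, of "\<lambda>M. M $$ (i, j)"] that \<open>j < ?n\<close> by (simp add: matrix_of_def)
    then have "(\<Sum>i<?n. scale (representation (set bs) ((f ^^ m) (bs ! j)) (bs ! i)) (bs ! i)) = 0"
      by simp
    then show ?thesis by (simp add: sum_representation_nth [OF bs])
  qed
  then have "\<And>b. b \<in> set bs \<Longrightarrow> (f ^^ m) b = 0" by (auto simp: in_set_conv_nth)
  moreover have "v \<in> span (set bs)" using bs by (simp add: ordered_basis_def)
  ultimately show ?thesis
    using linear_funpow [OF f, of m] module_hom.eq_0_on_span [of scale scale "f ^^ m" "set bs" v]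
    by (simp add: module_hom_eq_linear)
qed

end

section \<open>Invariance under isomorphism\<close>

text \<open>The inverse is a parameter of the locale, so that the situation is symmetric in the two
  spaces and each transfer result need only be shown in one direction.\<close>

locale linear_space_iso = V: linear_space s1 + W: linear_space s2 +
    f: Vector_Spaces.linear s1 s2 f + g: Vector_Spaces.linear s2 s1 g
  for s1 :: "'a::field \<Rightarrow> 'b::ab_group_add \<Rightarrow> 'b" and s2 :: "'a \<Rightarrow> 'c::ab_group_add \<Rightarrow> 'c"
    and f :: "'b \<Rightarrow> 'c" and g :: "'c \<Rightarrow> 'b" +
  assumes gf [simp]: "g (f x) = x" and fg [simp]: "f (g y) = y"
begin

lemma inverse: "linear_space_iso s2 s1 g f"
  by unfold_locales simp_all

lemma bij: "bij f"
  by (rule o_bij [of g]) auto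

lemma span_image_eq_UNIV: "V.span B = UNIV \<Longrightarrow> W.span (f ` B) = UNIV"
  using bij by (simp add: f.span_image bij_def)

lemma independent_image: "V.independent B \<Longrightarrow> W.independent (f ` B)"
  using bij by (intro f.independent_inj_image) (auto simp: bij_def)

lemma representation_image:
  assumes B: "V.independent B" "V.span B = UNIV" and b: "b \<in> B"
  shows "W.representation (f ` B) (f v) (f b) = V.representation B v b"
proof -
  note fB = independent_image [OF B(1)] span_image_eq_UNIV [OF B(2)]
  have lV: "Vector_Spaces.linear s1 (*) (\<lambda>v. V.representation B v b)"
    by (rule V.linear_representation [OF B])
  have lW: "Vector_Spaces.linear s1 (*) (\<lambda>v. W.representation (f ` B) (f v) (f b))"
    using Vector_Spaces.linear_compose [OF f.linear_axioms W.linear_representation [OF fB, of "f b"]]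
    by (simp add: comp_def)
  have pair: "vector_space_pair s1 ((*) :: 'a \<Rightarrow> 'a \<Rightarrow> 'a)"
    using lV by (simp add: Vector_Spaces.linear_iff vector_space_pair_def)
  have inj: "f c = f d \<longleftrightarrow> c = d" for c d
    by (metis gf)
  show ?thesis
  proof (rule vector_space_pair.linear_eq_on [OF pair lW lV])
    show "v \<in> V.span B" using B by simp
    show "W.representation (f ` B) (f c) (f b) = V.representation B c b" if "c \<in> B" for c
      using that b inj by (simp add: V.representation_basis [OF B(1)] W.representation_basis [OF fB(1)])
  qed
qed

text \<open>In corresponding bases, conjugate operators have the same matrix.\<close>

lemma nilpotent_jordan_sizes_image:
  assumes "\<And>x. f (h x) = k (f x)" and ns: "V.nilpotent_jordan_sizes h ns"
  shows "W.nilpotent_jordan_sizes k ns"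
proof -
  obtain bs where bs: "V.ordered_basis bs"
    and J: "jordan_nf (V.matrix_of bs h) (map (\<lambda>k. (k, 0)) ns)"
    using ns by (auto simp: V.nilpotent_jordan_sizes_def)
  then have ind: "V.independent (set bs)" and span: "V.span (set bs) = UNIV" and dist: "distinct bs"
    by (auto simp: V.ordered_basis_def)
  have "distinct (map f bs)"
    using dist by (auto simp: distinct_map intro: inj_on_inverseI [of _ g])
  then have "W.ordered_basis (map f bs)"
    using independent_image [OF ind] span_image_eq_UNIV [OF span] by (simp add: W.ordered_basis_def)
  moreover have "W.matrix_of (map f bs) k = V.matrix_of bs h"
    unfolding W.matrix_of_def V.matrix_of_def
    by (rule eq_matI) (auto simp: assms(1) [symmetric] representation_image [OF ind span])
  ultimately show ?thesis
    using J ns by (auto simp: W.nilpotent_jordan_sizes_def V.nilpotent_jordan_sizes_def)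
qed

end

context lie_algebra
begin

sublocale left: Vector_Spaces.linear scale scale "\<lambda>x. bracket x y" for y by (rule linear_left)
sublocale right: Vector_Spaces.linear scale scale "\<lambda>y. bracket x y" for x by (rule linear_right)

lemma bracket_skew: "bracket y x = - bracket x y"
proof -
  have "bracket (x + y) (x + y) = (bracket x x + bracket y x) + (bracket x y + bracket y y)"
    by (simp only: left.add right.add)
  then have "bracket y x + bracket x y = 0"
    by (simp add: alternating)
  then show ?thesis by (simp only: eq_neg_iff_add_eq_0)
qed

end

locale lie_algebra_iso = V: lie_algebra s1 b1 + W: lie_algebra s2 b2 + linear_space_iso s1 s2 f g
  for s1 :: "'a::field \<Rightarrow> 'b::ab_group_add \<Rightarrow> 'b" and b1 and s2 :: "'a \<Rightarrow> 'c::ab_group_add \<Rightarrow> 'c" and b2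
    and f :: "'b \<Rightarrow> 'c" and g :: "'c \<Rightarrow> 'b" +
  assumes hom: "f (b1 x y) = b2 (f x) (f y)"
begin

lemma lower_central_image: "W.lower_central k = f ` V.lower_central k"
proof (induction k)
  case 0
  then show ?case using bij by (simp add: bij_def)
next
  case (Suc k)
  have "{b2 x y | x y. x \<in> f ` V.lower_central k} = f ` {b1 x y | x y. x \<in> V.lower_central k}"
  proof (intro equalityI subsetI)
    fix z assume "z \<in> {b2 x y | x y. x \<in> f ` V.lower_central k}"
    then obtain x y where "z = b2 (f x) (f (g y))" "x \<in> V.lower_central k" by auto
    then show "z \<in> f ` {b1 x y | x y. x \<in> V.lower_central k}"
      unfolding hom [symmetric] by blast
  next
    fix z assume "z \<in> f ` {b1 x y | x y. x \<in> V.lower_central k}"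
    then show "z \<in> {b2 x y | x y. x \<in> f ` V.lower_central k}" by (fastforce simp: hom)
  qed
  with Suc show ?case by (simp add: f.span_image)
qed

lemma two_step_nilpotent_image: "V.two_step_nilpotent \<Longrightarrow> W.two_step_nilpotent"
proof -
  have "f ` A = {0} \<longleftrightarrow> A = {0}" for A
    using bij by (metis bij_def f.zero image_empty image_insert inj_image_eq_iff)
  then show "V.two_step_nilpotent \<Longrightarrow> W.two_step_nilpotent"
    unfolding V.two_step_nilpotent_def W.two_step_nilpotent_def lower_central_image by simp
qed

lemma char_seq_at_image: "W.char_seq_at (f x) = V.char_seq_at x"
proof -
  interpret inv: linear_space_iso s2 s1 g f by (rule inverse)
  have "W.nilpotent_jordan_sizes (W.ad (f x)) ns \<longleftrightarrow> V.nilpotent_jordan_sizes (V.ad x) ns" for ns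
    using nilpotent_jordan_sizes_image [of "V.ad x" "W.ad (f x)" ns]
      inv.nilpotent_jordan_sizes_image [of "W.ad (f x)" "V.ad x" ns]
    by (metis hom gf fg)
  then show ?thesis by (simp add: V.char_seq_at_def W.char_seq_at_def)
qed

lemma char_seq_image: "W.char_seq = V.char_seq"
proof -
  have "{W.char_seq_at y | y. y \<notin> W.lower_central 1} = {V.char_seq_at x | x. x \<notin> V.lower_central 1}"
  proof (intro equalityI subsetI)
    fix ns assume "ns \<in> {W.char_seq_at y | y. y \<notin> W.lower_central 1}"
    then obtain y where y: "ns = W.char_seq_at y" "y \<notin> f ` V.lower_central 1"
      by (auto simp only: lower_central_image)
    have "g y \<notin> V.lower_central 1" using y(2) by (metis fg imageI)
    moreover have "ns = V.char_seq_at (g y)"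
      using y(1) char_seq_at_image [of "g y"] by simp
    ultimately show "ns \<in> {V.char_seq_at x | x. x \<notin> V.lower_central 1}" by blast
  next
    fix ns assume "ns \<in> {V.char_seq_at x | x. x \<notin> V.lower_central 1}"
    then obtain x where x: "ns = V.char_seq_at x" "x \<notin> V.lower_central 1" by blast
    have "f x \<notin> W.lower_central 1"
      using x(2) by (auto simp only: lower_central_image) (metis gf)
    then show "ns \<in> {W.char_seq_at y | y. y \<notin> W.lower_central 1}"
      using x(1) char_seq_at_image [of x] by force
  qed
  then show ?thesis by (simp add: V.char_seq_def W.char_seq_def)
qed

lemma lie_isomorphic: "lie_isomorphic s1 b1 s2 b2"
  unfolding lie_isomorphic_def using f.linear_axioms bij hom by blast

end

lemma (in linear_space_iso) lie_algebra_iso_transport: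
  assumes "lie_algebra s1 b1"
  shows "lie_algebra_iso s1 b1 s2 (\<lambda>x y. f (b1 (g x) (g y))) f g"
proof -
  interpret L: lie_algebra s1 b1 by fact
  let ?b = "\<lambda>x y. f (b1 (g x) (g y))"
  interpret lie_algebra s2 ?b
  proof
    show "?b x x = 0" for x by (simp add: L.alternating)
    show "?b x (?b y z) + ?b y (?b z x) + ?b z (?b x y) = 0" for x y z
      by (simp add: f.add [symmetric] L.jacobi)
  qed (simp_all add: Vector_Spaces.linear_iff W.vector_space_axioms
      f.add f.scale g.add g.scale L.left.add L.left.scale L.right.add L.right.scale)
  show ?thesis by unfold_locales simp
qed

section \<open>Nilpotency class and rank\<close>

context lie_algebra
begin

lemma subspace_lower_central: "subspace (lower_central k)"
  by (cases k) auto

lemma funpow_ad_in_lower_central: "(ad x ^^ k) y \<in> lower_central k"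
proof (induction k)
  case (Suc k)
  let ?u = "(ad x ^^ k) y"
  have "bracket ?u x \<in> lower_central (Suc k)"
    using Suc by (auto intro: span_base)
  then have "- bracket ?u x \<in> lower_central (Suc k)"
    by (rule subspace_neg [OF subspace_lower_central])
  then show ?case using bracket_skew [of x ?u] by (simp only: funpow.simps comp_apply)
qed simp

lemma derived_proper_if_nilpotent:
  assumes "nilpotent" and "(v :: 'g) \<noteq> 0"
  shows "lower_central 1 \<noteq> UNIV"
proof
  assume *: "lower_central 1 = UNIV"
  have "lower_central k = UNIV" for k
  proof (induction k)
    case (Suc k)
    then show ?case using * by simp
  qed simp
  with assms show False by (auto simp: nilpotent_def)
qed

lemma char_seq_at_jordan_sizes:
  assumes fin: "finite B" "span B = UNIV" and "nilpotent"
  shows "nilpotent_jordan_sizes (ad x) (char_seq_at x)"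
proof -
  obtain m where m: "lower_central m = {0}"
    using \<open>nilpotent\<close> by (auto simp: nilpotent_def)
  have "(ad x ^^ m) y = 0" for y
    using funpow_ad_in_lower_central [of m x y] m by simp
  then have "\<exists>ns. nilpotent_jordan_sizes (ad x) ns"
    by (rule nilpotent_jordan_sizes_exists [OF fin linear_right])
  then have "\<exists>!ns. nilpotent_jordan_sizes (ad x) ns"
    using nilpotent_jordan_sizes_unique [OF linear_right] by blast
  then show ?thesis
    unfolding char_seq_at_def by (rule theI')
qed

text \<open>The point is the finiteness of the set over which the maximum is taken.\<close>

lemma char_seq_at_le_char_seq:
  assumes fin: "finite B" "span B = UNIV" and "nilpotent" and x: "x \<notin> lower_central 1"
  shows "char_seq_at x \<le> char_seq"
proof -
  let ?S = "{char_seq_at x | x. x \<notin> lower_central 1}"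
  have "?S \<subseteq> {ns. set ns \<subseteq> {..dim UNIV} \<and> length ns \<le> dim UNIV}"
    using nilpotent_jordan_sizes_bounded [OF char_seq_at_jordan_sizes [OF fin \<open>nilpotent\<close>]] by blast
  then have "finite ?S"
    by (rule finite_subset) (simp add: finite_lists_length_le)
  then show ?thesis
    unfolding char_seq_def using x by (intro Max_ge) auto
qed

lemma double_eq_0_iff:
  assumes "(2 :: 'k) \<noteq> 0"
  shows "a + a = 0 \<longleftrightarrow> (a :: 'g) = 0"
proof -
  have "a + a = scale 2 a"
    using scale_left_distrib [of 1 1 a] by simp
  with assms show ?thesis by simp
qed

text \<open>The sequence only sees elements outside the derived algebra. An element \<open>x\<close> inside it is
  reached through \<open>x + v\<close> and \<open>x - v\<close> with \<open>v\<close> outside: the mixed terms of the two squares cancel in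
  the sum, which leaves \<open>2 (ad x)\<^sup>2 = 0\<close>.\<close>

lemma ad_square_eq_0_if_char_seq_22:
  assumes two: "(2 :: 'k) \<noteq> 0" and fin: "finite B" "span B = UNIV" and "nilpotent"
    and seq: "char_seq = seq_22 n"
  shows "bracket x (bracket x y) = 0"
proof (cases "\<forall>v :: 'g. v = 0")
  case False
  then obtain v where v: "v \<notin> lower_central 1"
    using derived_proper_if_nilpotent [OF \<open>nilpotent\<close>] by auto
  have outside: "bracket x (bracket x y) = 0" if x: "x \<notin> lower_central 1" for x y
  proof -
    let ?ns = "char_seq_at x"
    note ns = char_seq_at_jordan_sizes [OF fin \<open>nilpotent\<close>, of x]
    have "?ns \<le> 2 # 2 # replicate (n - 4) 1"
      using char_seq_at_le_char_seq [OF fin \<open>nilpotent\<close> x] seq by (simp add: seq_22_def)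
    moreover have "sorted_wrt (\<ge>) ?ns"
      using ns by (simp add: nilpotent_jordan_sizes_def)
    \<comment> \<open>lexicographically below \<open>(2,2,1,\<dots>,1)\<close> and decreasing: the first entry bounds all others\<close>
    ultimately have "\<forall>k\<in>set ?ns. k \<le> 2"
      by (cases ?ns) auto
    from funpow_eq_0_of_jordan_sizes [OF linear_right ns this]
    show ?thesis by (simp add: numeral_2_eq_2)
  qed
  show ?thesis
  proof (cases "x \<in> lower_central 1")
    case True
    have "x + v \<notin> lower_central 1" "x - v \<notin> lower_central 1"
      using v True subspace_diff [OF subspace_lower_central, of "x + v" 1 x]
        subspace_diff [OF subspace_lower_central, of x 1 "x - v"] by auto
    then have "bracket (x + v) (bracket (x + v) y) = 0" "bracket (x - v) (bracket (x - v) y) = 0"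
      by (auto intro: outside)
    then have "bracket x (bracket x y) + (bracket x (bracket v y) + bracket v (bracket x y)) = 0"
      "bracket x (bracket x y) - (bracket x (bracket v y) + bracket v (bracket x y)) = 0"
      using outside [OF v, of y]
      by (simp_all add: left.add right.add left.diff right.diff algebra_simps)
    then have "bracket x (bracket x y) + bracket x (bracket x y) = 0"
      by (metis add.right_neutral add_diff_eq diff_add_eq eq_iff_diff_eq_0)
    with two show ?thesis by (simp add: double_eq_0_iff)
  qed (rule outside)
qed simp

text \<open>Polarising \<open>[x, [x, z]] = 0\<close> shows that \<open>[x, [y, z]]\<close> changes sign under each exchange of
  arguments, hence is invariant under cyclic permutations; the Jacobi identity becomes
  \<open>3 [x, [y, z]] = 0\<close>.\<close>

lemma class_2_if_ad_square_eq_0: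
  assumes three: "(3 :: 'k) \<noteq> 0" and sq: "\<And>x y. bracket x (bracket x y) = 0"
  shows "bracket x (bracket y z) = 0"
proof -
  let ?T = "\<lambda>x y z. bracket x (bracket y z)"
  have swap: "?T y x z = - ?T x y z" for x y z
  proof -
    have "?T (x + y) (x + y) z = ?T x x z + ?T x y z + (?T y x z + ?T y y z)"
      by (simp only: left.add right.add add.assoc add.left_commute)
    then have "?T x y z + ?T y x z = 0" by (simp add: sq)
    then show ?thesis by (simp add: eq_neg_iff_add_eq_0 add.commute)
  qed
  have swap': "?T x z y = - ?T x y z" for x y z
    using bracket_skew [of z y] by (simp add: right.neg)
  have "?T y z x = ?T x y z" by (metis swap swap' minus_minus)
  moreover have "?T z x y = ?T x y z" by (metis swap swap' minus_minus)
  ultimately have "?T x y z + ?T x y z + ?T x y z = 0"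
    using jacobi [of x y z] by simp
  moreover have "?T x y z + ?T x y z + ?T x y z = scale 3 (?T x y z)"
    using scale_left_distrib [of 2 1 "?T x y z"] scale_left_distrib [of 1 1 "?T x y z"] by simp
  ultimately show ?thesis using three by simp
qed

lemma two_step_nilpotentI:
  assumes class2: "\<And>x y z. bracket x (bracket y z) = 0" and "bracket u v \<noteq> 0"
  shows "two_step_nilpotent"
proof -
  have derived: "bracket x y = 0" if "x \<in> lower_central 1" for x y
  proof -
    have "bracket z y = 0" if "z \<in> {bracket u v | u v. True}" for z
      using that class2 bracket_skew [of z y] by auto
    then show ?thesis
      using that left.eq_0_on_span [of "{bracket u v | u v. True}" y x] by simp
  qed
  have "lower_central 2 = span {bracket x y | x y. x \<in> lower_central 1}"
    by (simp add: numeral_2_eq_2)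
  also have "{bracket x y | x y. x \<in> lower_central 1} = {0}"
  proof (intro equalityI subsetI)
    fix v :: 'g assume "v \<in> {0}"
    then have "v = bracket 0 0" by (simp add: left.zero)
    moreover have "0 \<in> lower_central 1" by (rule subspace_0 [OF subspace_lower_central])
    ultimately show "v \<in> {bracket x y | x y. x \<in> lower_central 1}" by blast
  qed (use derived in blast)
  finally have "lower_central 2 = {0}" by simp
  moreover have "bracket u v \<in> lower_central 1"
    by (auto intro: span_base)
  ultimately show ?thesis
    using assms(2) by (auto simp: two_step_nilpotent_def)
qed

end

context linear_space
begin

lemma in_span_pair_iff: "v \<in> span {a, b} \<longleftrightarrow> (\<exists>x y. v = scale x a + scale y b)"
  by (auto simp: span_breakdown_eq algebra_simps)

lemma independent_three:
  assumes *: "\<And>x y z. scale x a + scale y b + scale z c = 0 \<Longrightarrow> x = 0 \<and> y = 0 \<and> z = 0"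
  shows "independent {a, b, c}" "card {a, b, c} = 3"
proof -
  have c: "c \<noteq> 0" using * [of 0 0 1] by auto
  have b: "b \<notin> span {c}"
  proof
    assume "b \<in> span {c}"
    then obtain k where "b = scale k c" by (auto simp: span_breakdown_eq)
    then show False using * [of 0 1 "- k"] by simp
  qed
  have a: "a \<notin> span {b, c}"
  proof
    assume "a \<in> span {b, c}"
    then obtain k l where "a = scale k b + scale l c" by (auto simp: in_span_pair_iff)
    then show False using * [of 1 "- k" "- l"] by (simp add: algebra_simps)
  qed
  have "a \<notin> {b, c}" "b \<noteq> c"
    using a b span_base [of a "{b, c}"] span_base [of b "{c}"] by auto
  then show "card {a, b, c} = 3" by simp
  show "independent {a, b, c}"
    using independent_insertI [OF a independent_insertI [OF b]] c by simp
qed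

text \<open>Suppose that \<open>D k\<close> is independent of \<open>A d\<close> and \<open>A e\<close>, and let \<open>p\<close>, \<open>q\<close> be coordinate functionals dual to
  \<open>A d\<close>, \<open>A e\<close> that vanish on \<open>D k\<close>. The operator \<open>A + t D\<close> maps \<open>k\<close> to \<open>t D k\<close>, and the coordinates \<open>p\<close>, \<open>q\<close> of the
  images of \<open>d\<close> and \<open>e\<close> form a matrix with determinant \<open>1 + t s + t\<^sup>2 m\<close>. For a nonzero \<open>t\<close> at which this
  does not vanish, the images of \<open>d\<close>, \<open>e\<close>, \<open>k\<close> are independent, so the rank exceeds 2.\<close>

lemma kernel_mapped_into_range_if_rank_le_2:
  assumes char: "(2 :: 'a) \<noteq> 0" "(3 :: 'a) \<noteq> 0"
    and fin: "finite B" "span B = UNIV"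
    and A: "Vector_Spaces.linear scale scale A" and D: "Vector_Spaces.linear scale scale D"
    and rank: "\<And>t. dim (range (\<lambda>v. A v + scale t (D v))) \<le> 2"
    and ind: "independent {A d, A e}" "A d \<noteq> A e" and k: "A k = 0"
  shows "D k \<in> span {A d, A e}"
proof (rule ccontr)
  assume not: "D k \<notin> span {A d, A e}"
  define C where "C = extend_basis {D k, A d, A e}"
  have "independent {D k, A d, A e}"
    using not ind(1) by (rule independent_insertI)
  from extend_basis_superset [OF this] independent_extend_basis [OF this] span_extend_basis [OF this]
  have C: "{D k, A d, A e} \<subseteq> C" "independent C" "span C = UNIV" by (auto simp: C_def)
  have "finite C"
    using independent_span_bound [OF fin(1) C(2)] fin by simp
  with C interpret finite_dimensional_vector_space scale C by unfold_locales auto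
  have "D k \<noteq> A d" "D k \<noteq> A e" using not span_base by auto
  let ?p = "\<lambda>v. representation C v (A d)" and ?q = "\<lambda>v. representation C v (A e)"
  interpret p: Vector_Spaces.linear scale "(*)" ?p by (rule linear_representation [OF C(2,3)])
  interpret q: Vector_Spaces.linear scale "(*)" ?q by (rule linear_representation [OF C(2,3)])
  have pq: "?p (A d) = 1" "?p (A e) = 0" "?p (D k) = 0" "?q (A d) = 0" "?q (A e) = 1" "?q (D k) = 0"
    using C(1) ind(2) \<open>D k \<noteq> A d\<close> \<open>D k \<noteq> A e\<close>
    by (auto simp: representation_basis [OF C(2)])
  define s where "s = ?p (D d) + ?q (D e)"
  define m where "m = ?p (D d) * ?q (D e) - ?q (D d) * ?p (D e)"
  \<comment> \<open>a polynomial of degree at most 2 with constant term 1 cannot vanish at all of \<open>1, -1, 2\<close>, which are distinct and nonzero\<close>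
  have "\<exists>t. t \<noteq> 0 \<and> 1 + t * s + t * t * m \<noteq> 0"
  proof (rule ccontr)
    assume "\<not> ?thesis"
    then have all: "t \<noteq> 0 \<Longrightarrow> 1 + t * s + t * t * m = 0" for t by blast
    have e1: "1 + s + m = 0" using all [of 1] by simp
    have e2: "1 - s + m = 0" using all [of "- 1"] by simp
    have "2 * s = (1 + s + m) - (1 - s + m)" by (simp add: algebra_simps)
    then have "s = 0" using e1 e2 char by simp
    then have "m = - 1" using e1 by (simp add: eq_neg_iff_add_eq_0 add.commute)
    with \<open>s = 0\<close> have "1 + 2 * s + 2 * 2 * m = - 3" by simp
    with all [of 2] char show False by simp
  qed
  then obtain t where t: "t \<noteq> 0" "1 + t * s + t * t * m \<noteq> 0" by blast
  let ?f = "\<lambda>v. A v + scale t (D v)"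
  have indep: "x = 0 \<and> y = 0 \<and> z = 0"
    if *: "scale x (?f d) + scale y (?f e) + scale z (?f k) = 0" for x y z
  proof -
    let ?v = "scale x (?f d) + scale y (?f e) + scale z (?f k)"
    have "?p ?v = 0" "?q ?v = 0" using * by (simp_all add: p.zero q.zero)
    then have 1: "x * (1 + t * ?p (D d)) + y * (t * ?p (D e)) = 0"
      and 2: "x * (t * ?q (D d)) + y * (1 + t * ?q (D e)) = 0"
      by (simp_all add: p.add p.scale q.add q.scale pq k)
    \<comment> \<open>Cramer's rule for the linear system 1, 2 in \<open>x\<close> and \<open>y\<close>, whose determinant is nonzero\<close>
    have "x * (1 + t * s + t * t * m) =
        (x * (1 + t * ?p (D d)) + y * (t * ?p (D e))) * (1 + t * ?q (D e)) -
        (x * (t * ?q (D d)) + y * (1 + t * ?q (D e))) * (t * ?p (D e))"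
      by (simp add: s_def m_def algebra_simps)
    then have x: "x = 0" using 1 2 t by simp
    have "y * (1 + t * s + t * t * m) =
        (x * (t * ?q (D d)) + y * (1 + t * ?q (D e))) * (1 + t * ?p (D d)) -
        (x * (1 + t * ?p (D d)) + y * (t * ?p (D e))) * (t * ?q (D d))"
      by (simp add: s_def m_def algebra_simps)
    then have y: "y = 0" using 1 2 t by simp
    have "D k \<noteq> 0" using not span_zero by metis
    then have "z = 0" using * x y t k by simp
    with x y show ?thesis by simp
  qed
  have "card {?f d, ?f e, ?f k} \<le> dim (range ?f)"
    using independent_three(1) [OF indep] by (intro independent_card_le_dim) auto
  with independent_three(2) [OF indep] rank [of t] show False by simp
qed

end

section \<open>Adapted bases and product tables\<close>

context linear_space
begin

text \<open>The products prescribed on basis vectors, as functions of the basis: in this form they can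
  be compared between an arbitrary Lie algebra and \<open>\<bbbK>\<^sup>n\<close>.\<close>

definition mu0_table :: "(nat \<Rightarrow> 'b) \<Rightarrow> nat \<Rightarrow> nat \<Rightarrow> 'b" where
  "mu0_table X i j = (if (i, j) = (1, 2) then X 3 else if (i, j) = (1, 4) then X 5 else 0)"

definition phi1_table :: "(nat \<Rightarrow> nat \<Rightarrow> 'a) \<Rightarrow> (nat \<Rightarrow> nat \<Rightarrow> 'a) \<Rightarrow> (nat \<Rightarrow> 'b) \<Rightarrow> nat \<Rightarrow> nat \<Rightarrow> 'b" where
  "phi1_table a3 a5 X i j =
     (if 2 \<le> i \<and> i \<notin> {3, 5} \<and> j \<notin> {3, 5}
      then scale (a3 i j) (X 3) + scale (a5 i j) (X 5) else 0)"

definition phi2_table ::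
    "nat \<Rightarrow> (nat \<Rightarrow> nat \<Rightarrow> 'a) \<Rightarrow> (nat \<Rightarrow> nat \<Rightarrow> 'a) \<Rightarrow> (nat \<Rightarrow> 'b) \<Rightarrow> nat \<Rightarrow> nat \<Rightarrow> 'b" where
  "phi2_table n a3 a5 X i j =
     (if (i, j) = (2, 4) then X n
      else if 2 \<le> i \<and> j \<le> n - 1 \<and> i \<notin> {3, 5} \<and> j \<notin> {3, 5}
      then scale (a3 i j) (X 3) + scale (a5 i j) (X 5) else 0)"

lemma is_mu0_iff: "is_mu0 n X \<beta> \<longleftrightarrow> skew_with_products n X (mu0_table X) \<beta>"
  by (simp add: is_mu0_def mu0_table_def [abs_def])

lemma is_phi1_iff: "is_phi1 n X \<phi> \<longleftrightarrow> (\<exists>a3 a5. skew_with_products n X (phi1_table a3 a5 X) \<phi>)"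
  by (simp add: is_phi1_def phi1_table_def [abs_def])

lemma is_phi2_iff: "is_phi2 n X \<phi> \<longleftrightarrow> (\<exists>a3 a5. skew_with_products n X (phi2_table n a3 a5 X) \<phi>)"
  by (simp add: is_phi2_def phi2_table_def [abs_def])

text \<open>With \<open>r i\<close> the coordinate functionals, the map is the sum of \<open>t i j\<close> times the \<open>2 \<times> 2\<close> minor
  \<open>r i v * r j w - r j v * r i w\<close> over all \<open>i < j\<close>.\<close>

lemma skew_with_products_exists:
  assumes X: "indexed_basis n X"
  shows "\<exists>\<beta>. skew_with_products n X t \<beta>"
proof -
  define r where "r i v = representation (X ` {1..n}) v (X i)" for i v
  have B: "independent (X ` {1..n})" "span (X ` {1..n}) = UNIV" and inj: "inj_on X {1..n}"
    using X by (auto simp: indexed_basis_def)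
  have "Vector_Spaces.linear scale (*) (r i)" for i
    unfolding r_def by (rule linear_representation [OF B])
  then have r_add: "r i (v + w) = r i v + r i w" and r_scale: "r i (scale c v) = c * r i v" for i v w c
    by (simp_all add: Vector_Spaces.linear_iff)
  have r_X: "r i (X j) = (if i = j then 1 else 0)" if "i \<in> {1..n}" "j \<in> {1..n}" for i j
  proof -
    have "representation (X ` {1..n}) (X j) = (\<lambda>v. if v = X j then 1 else 0)"
      using that by (intro representation_basis [OF B(1)]) auto
    then show ?thesis
      unfolding r_def using inj_on_eq_iff [OF inj that] by simp
  qed
  define \<beta> where "\<beta> v w = (\<Sum>i\<in>{1..n}. \<Sum>j\<in>{i<..n}. scale (r i v * r j w - r j v * r i w) (t i j))" for v w
  have "\<beta> v (x + y) = \<beta> v x + \<beta> v y" for v x y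
    unfolding \<beta>_def sum.distrib [symmetric]
    by (intro sum.cong refl) (simp add: r_add algebra_simps)
  moreover have "\<beta> v (scale c x) = scale c (\<beta> v x)" for v c x
    unfolding \<beta>_def scale_sum_right
    by (intro sum.cong refl) (simp add: r_scale algebra_simps)
  ultimately have "Vector_Spaces.linear scale scale (\<beta> v)" for v
    by (simp add: Vector_Spaces.linear_iff vector_space_axioms)
  moreover have "\<beta> w v = - \<beta> v w" for v w
    unfolding \<beta>_def sum_negf [symmetric]
    by (intro sum.cong refl) (simp add: algebra_simps)
  moreover have "\<beta> (X k) (X l) = t k l" if kl: "1 \<le> k" "k < l" "l \<le> n" for k l
  proof -
    have "scale (r i (X k) * r j (X l) - r j (X k) * r i (X l)) (t i j) =
        (if j = l then if i = k then t i j else 0 else 0)"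
      if "i \<in> {1..n}" "j \<in> {i<..n}" for i j
      using that kl by (auto simp: r_X)
    then have "\<beta> (X k) (X l) =
        (\<Sum>i\<in>{1..n}. \<Sum>j\<in>{i<..n}. if j = l then if i = k then t i j else 0 else 0)"
      unfolding \<beta>_def by (intro sum.cong refl) auto
    also have "\<dots> = (\<Sum>i\<in>{1..n}. if i = k then t k l else 0)"
      using kl by (intro sum.cong refl) (auto simp: sum.delta)
    also have "\<dots> = t k l" using kl by simp
    finally show ?thesis .
  qed
  ultimately show ?thesis
    unfolding skew_with_products_def skew_bilinear_def by blast
qed

text \<open>This is what allows a bracket given by its products to be written as \<open>\<mu>\<^sub>0 + \<phi>\<close>.\<close>

lemma skew_with_products_split:
  assumes X: "indexed_basis n X" and \<mu>: "skew_with_products n X (\<lambda>i j. t i j + u i j) \<mu>"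
  obtains \<beta> \<phi> where "skew_with_products n X t \<beta>" "skew_with_products n X u \<phi>"
    "\<mu> = (\<lambda>x y. \<beta> x y + \<phi> x y)"
proof -
  obtain \<beta> where \<beta>: "skew_with_products n X t \<beta>"
    using skew_with_products_exists [OF X] by blast
  define \<phi> where "\<phi> x y = \<mu> x y - \<beta> x y" for x y
  note unfold = skew_with_products_def skew_bilinear_def
  have lin: "Vector_Spaces.linear scale scale (\<mu> x)" "Vector_Spaces.linear scale scale (\<beta> x)"
    and skew: "\<mu> y x = - \<mu> x y" "\<beta> y x = - \<beta> x y"
    and prod: "1 \<le> i \<and> i < j \<and> j \<le> n \<Longrightarrow> \<mu> (X i) (X j) = t i j + u i j"
      "1 \<le> i \<and> i < j \<and> j \<le> n \<Longrightarrow> \<beta> (X i) (X j) = t i j" for x y i j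
    using \<mu> \<beta> unfolding unfold by blast+
  have "Vector_Spaces.linear scale scale (\<phi> x)" for x
    using lin [of x] by (simp add: Vector_Spaces.linear_iff \<phi>_def scale_right_diff_distrib)
  moreover have "\<phi> y x = - \<phi> x y" for x y
    unfolding \<phi>_def by (subst (1 2) skew) simp
  moreover have "\<phi> (X i) (X j) = u i j" if "1 \<le> i \<and> i < j \<and> j \<le> n" for i j
    using prod [OF that] by (simp add: \<phi>_def)
  ultimately have "skew_with_products n X u \<phi>"
    unfolding unfold by blast
  then show thesis
    by (rule that [OF \<beta>]) (auto simp: \<phi>_def)
qed

lemma indexed_basis_nth:
  assumes "ordered_basis bs"
  shows "indexed_basis (length bs) (\<lambda>i. bs ! (i - 1))"
proof -
  have img: "(\<lambda>i. bs ! (i - 1)) ` {1..length bs} = set bs"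
  proof (intro equalityI subsetI)
    fix v assume "v \<in> set bs"
    then obtain i where "i < length bs" "v = bs ! i" by (auto simp: in_set_conv_nth)
    then show "v \<in> (\<lambda>i. bs ! (i - 1)) ` {1..length bs}"
      by (intro image_eqI [of _ _ "Suc i"]) auto
  qed auto
  have "inj_on (\<lambda>i. bs ! (i - 1)) {1..length bs}"
    using assms by (auto simp: inj_on_def ordered_basis_def nth_eq_iff_index_eq)
  with img assms show ?thesis
    by (simp add: indexed_basis_def ordered_basis_def)
qed

end

lemma indexed_bases_isomorphic:
  assumes "linear_space s1" "linear_space s2"
    and Y: "linear_space.indexed_basis s1 n Y" and X: "linear_space.indexed_basis s2 n X"
  obtains f g where "linear_space_iso s1 s2 f g" "\<And>i. i \<in> {1..n} \<Longrightarrow> f (Y i) = X i"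
proof -
  have extend: "\<exists>f. Vector_Spaces.linear s s' f \<and> (\<forall>i\<in>{1..n}. f (P i) = Q i)"
    if "linear_space s" "linear_space s'" and P: "linear_space.indexed_basis s n P"
    for s :: "'a::field \<Rightarrow> 'd::ab_group_add \<Rightarrow> 'd" and s' :: "'a \<Rightarrow> 'e::ab_group_add \<Rightarrow> 'e" and P Q
  proof -
    interpret S: linear_space s by fact
    interpret S': linear_space s' by fact
    interpret pair: vector_space_pair s s' by unfold_locales
    have ind: "S.independent (P ` {1..n})" and inj: "inj_on P {1..n}"
      using P by (auto simp: S.indexed_basis_def)
    obtain f where "Vector_Spaces.linear s s' f"
      "\<forall>v\<in>P ` {1..n}. f v = Q (the_inv_into {1..n} P v)"
      using pair.linear_independent_extend [OF ind, of "\<lambda>v. Q (the_inv_into {1..n} P v)"] by blast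
    then show ?thesis using inj by (auto simp: the_inv_into_f_f)
  qed
  obtain f where f: "Vector_Spaces.linear s1 s2 f" "\<And>i. i \<in> {1..n} \<Longrightarrow> f (Y i) = X i"
    using extend [OF assms(1,2) Y, of X] by blast
  obtain g where g: "Vector_Spaces.linear s2 s1 g" "\<And>i. i \<in> {1..n} \<Longrightarrow> g (X i) = Y i"
    using extend [OF assms(2,1) X, of Y] by blast
  have inverse: "k (h v) = v"
    if "linear_space s" "linear_space.indexed_basis s n P" "Vector_Spaces.linear s s' h" "Vector_Spaces.linear s' s k"
      "\<And>i. i \<in> {1..n} \<Longrightarrow> k (h (P i)) = P i"
    for s :: "'a::field \<Rightarrow> 'd::ab_group_add \<Rightarrow> 'd" and s' :: "'a \<Rightarrow> 'e::ab_group_add \<Rightarrow> 'e" and P h k v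
  proof -
    interpret S: linear_space s by fact
    interpret pair: vector_space_pair s s by unfold_locales
    have "(k \<circ> h) v = id v"
    proof (rule pair.linear_eq_on [where f = "k \<circ> h" and g = id and x = v and B = "P ` {1..n}"])
      show "Vector_Spaces.linear s s (k \<circ> h)" by (rule Vector_Spaces.linear_compose [OF that(3,4)])
      show "Vector_Spaces.linear s s id" by (rule S.linear_idI)
      show "v \<in> S.span (P ` {1..n})" using that(2) by (simp add: S.indexed_basis_def)
      show "(k \<circ> h) b = id b" if "b \<in> P ` {1..n}" for b
        using that \<open>\<And>i. i \<in> {1..n} \<Longrightarrow> k (h (P i)) = P i\<close> by auto
    qed
    then show ?thesis by simp
  qed
  interpret V: linear_space s1 by fact
  interpret W: linear_space s2 by fact
  interpret f: Vector_Spaces.linear s1 s2 f by fact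
  interpret g: Vector_Spaces.linear s2 s1 g by fact
  have "g (f x) = x" for x by (rule inverse [OF assms(1) Y f(1) g(1)]) (simp add: f g)
  moreover have "f (g y) = y" for y by (rule inverse [OF assms(2) X g(1) f(1)]) (simp add: f g)
  ultimately have "linear_space_iso s1 s2 f g" by unfold_locales
  then show thesis using that f(2) by blast
qed

context lie_algebra
begin

lemma rank_2_if_breadth_2:
  assumes fin: "finite B" "span B = UNIV" and "breadth = 2"
  shows "dim (range (ad x)) \<le> 2" and "\<exists>x. dim (range (ad x)) = 2"
proof -
  let ?R = "{dim (range (ad x)) | x. True}"
  have "dim (range (ad x)) \<le> card B" for x
    using fin by (intro dim_le_card) auto
  then have "finite ?R"
    by (intro finite_subset [of ?R "{..card B}"]) auto
  have Max: "Max ?R = 2" using \<open>breadth = 2\<close> by (simp only: breadth_def)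
  have "2 \<in> ?R"
    unfolding Max [symmetric] by (rule Max_in [OF \<open>finite ?R\<close>]) blast
  then show "\<exists>x. dim (range (ad x)) = 2" by fastforce
  have "dim (range (ad x)) \<in> ?R" by blast
  then show "dim (range (ad x)) \<le> 2"
    unfolding Max [symmetric] by (rule Max_ge [OF \<open>finite ?R\<close>])
qed

text \<open>The vectors are independent for structural reasons: brackets are central, \<open>x1\<close> is not, and
  \<open>x2\<close>, \<open>x4\<close> are independent modulo the kernel of \<open>ad x1\<close>, which contains all the others. The remaining
  basis vectors can be chosen in that kernel, because it spans the whole space together with
  \<open>x2\<close> and \<open>x4\<close>. The list \<open>zs\<close> stands for further brackets that are to be placed last.\<close>

lemma ordered_basis_extending_kernel:
  assumes class2: "\<And>x y z. bracket x (bracket y z) = 0"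
    and fin: "finite B" "span B = UNIV"
    and ind: "independent (set zs \<union> {bracket x1 x2, bracket x1 x4})" and ne: "bracket x1 x2 \<noteq> bracket x1 x4"
    and zs: "distinct zs" "bracket x1 x2 \<notin> set zs" "bracket x1 x4 \<notin> set zs"
      "\<And>z. z \<in> set zs \<Longrightarrow> \<exists>u v. z = bracket u v"
    and range: "range (ad x1) \<subseteq> span {bracket x1 x2, bracket x1 x4}"
  obtains ms where "ordered_basis ([x1, x2, bracket x1 x2, x4, bracket x1 x4] @ ms @ zs)"
    "\<And>m. m \<in> set ms \<Longrightarrow> bracket x1 m = 0"
proof -
  let ?x3 = "bracket x1 x2" and ?x5 = "bracket x1 x4"
  define Z where "Z = set zs \<union> {?x3, ?x5}"
  have "?x3 \<noteq> 0" "?x5 \<noteq> 0"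
    using ind dependent_zero [of Z] by (auto simp: Z_def)
  have central: "bracket y z = 0" if "z \<in> Z" for y z
  proof -
    have "\<exists>u v. z = bracket u v" using that zs(4) by (auto simp: Z_def)
    then show ?thesis using class2 by blast
  qed
  have x1: "x1 \<notin> span Z"
  proof
    assume "x1 \<in> span Z"
    then have "bracket x2 x1 = 0" by (rule right.eq_0_on_span [rotated]) (rule central)
    then show False using bracket_skew [of x1 x2] \<open>?x3 \<noteq> 0\<close> by simp
  qed
  have kernel: "bracket x1 k = 0" if "k \<in> span (insert x1 Z)" for k
    using that by (rule right.eq_0_on_span [rotated]) (auto simp: alternating central)
  have x2: "x2 \<notin> span (insert x1 Z)"
    using kernel \<open>?x3 \<noteq> 0\<close> by blast
  have x4: "x4 \<notin> span (insert x2 (insert x1 Z))"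
  proof
    assume "x4 \<in> span (insert x2 (insert x1 Z))"
    then obtain c where "x4 - scale c x2 \<in> span (insert x1 Z)"
      by (auto simp: span_breakdown_eq)
    from kernel [OF this] have "?x5 = scale c ?x3"
      by (simp add: right.diff right.scale)
    then have "?x5 \<in> span {?x3}" by (simp add: span_scale span_base)
    moreover have "independent {?x5, ?x3}"
      using ind by (rule independent_mono) auto
    ultimately show False using ne by (simp add: independent_insert)
  qed
  let ?S = "insert x4 (insert x2 (insert x1 Z))"
  have indS: "independent ?S"
    using ind x1 x2 x4 by (intro independent_insertI) (auto simp: Z_def)
  let ?V = "{x2, x4} \<union> {k. bracket x1 k = 0}"
  have "?S \<subseteq> ?V" using alternating central by auto
  then obtain C where C: "?S \<subseteq> C" "C \<subseteq> ?V" "independent C" "?V \<subseteq> span C"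
    using maximal_independent_subset_extend [OF _ indS] by metis
  have "v \<in> span C" for v
  proof -
    obtain a b where ab: "bracket x1 v = scale a ?x3 + scale b ?x5"
      using range by (force simp: in_span_pair_iff)
    then have "v - (scale a x2 + scale b x4) \<in> ?V"
      by (simp add: right.add right.diff right.scale)
    then have "v - (scale a x2 + scale b x4) \<in> span C" using C(4) by blast
    moreover have "scale a x2 + scale b x4 \<in> span C"
      using C(4) by (intro span_add span_scale) auto
    ultimately show ?thesis using span_add by fastforce
  qed
  then have spanC: "span C = UNIV" by auto
  have "finite C"
    using independent_span_bound [OF fin(1) C(3)] fin by simp
  then obtain ms where ms: "set ms = C - ?S" "distinct ms"
    using finite_distinct_list [of "C - ?S"] by auto
  let ?bs = "[x1, x2, ?x3, x4, ?x5] @ ms @ zs"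
  have notin: "v \<notin> S" if "v \<notin> span S" for v S
    using that span_base by blast
  have "distinct ?bs"
    using notin [OF x1] notin [OF x2] notin [OF x4] ms zs ne by (auto simp: Z_def)
  moreover have "set ?bs = C" using ms C(1) by (auto simp: Z_def)
  ultimately have "ordered_basis ?bs"
    using C(3) spanC by (simp add: ordered_basis_def)
  moreover have "bracket x1 m = 0" if "m \<in> set ms" for m
    using that ms C(2) by auto
  ultimately show thesis by (rule that)
qed

end

section \<open>Normal form and classification\<close>

context lie_algebra
begin

text \<open>Both families are treated with one basis, whose last part \<open>zs\<close> is empty or consists of
  \<open>[x2, x4]\<close> according to whether this bracket lies in the span of \<open>x3\<close> and \<open>x5\<close>.\<close>

lemma normal_form_if_class_2_breadth_2:
  assumes char: "(2 :: 'k) \<noteq> 0" "(3 :: 'k) \<noteq> 0"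
    and class2: "\<And>x y z. bracket x (bracket y z) = 0"
    and fin: "finite B" "span B = UNIV" and "breadth = 2" and n: "n = dim UNIV"
  obtains Y where "indexed_basis n Y" "5 \<le> n"
    "(\<exists>a3 a5. skew_with_products n Y (\<lambda>i j. mu0_table Y i j + phi1_table a3 a5 Y i j) bracket) \<or>
     (\<exists>a3 a5. skew_with_products n Y (\<lambda>i j. mu0_table Y i j + phi2_table n a3 a5 Y i j) bracket)"
proof -
  note rank_le = rank_2_if_breadth_2(1) [OF fin \<open>breadth = 2\<close>]
  obtain x1 where x1: "dim (range (ad x1)) = 2"
    using rank_2_if_breadth_2(2) [OF fin \<open>breadth = 2\<close>] by blast
  obtain P where P: "P \<subseteq> range (ad x1)" "independent P" "range (ad x1) \<subseteq> span P" "card P = 2"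
    using basis_exists [of "range (ad x1)"] x1 by metis
  then obtain x2 x4 where "P = {bracket x1 x2, bracket x1 x4}" and ne: "bracket x1 x2 \<noteq> bracket x1 x4"
    by (auto simp: card_2_iff)
  define x3 where "x3 = bracket x1 x2"
  define x5 where "x5 = bracket x1 x4"
  let ?I = "span {x3, x5}"
  have range: "range (ad x1) \<subseteq> ?I" and ind: "independent {x3, x5}" and ne: "x3 \<noteq> x5"
    using P \<open>P = _\<close> ne by (auto simp: x3_def x5_def)
  \<comment> \<open>maximality of the rank of \<open>ad x1\<close> among all \<open>ad (x1 + t y)\<close>\<close>
  have kernel: "bracket y k \<in> ?I" if "bracket x1 k = 0" for y k
    unfolding x3_def x5_def
  proof (rule kernel_mapped_into_range_if_rank_le_2 [OF char fin linear_right linear_right])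
    show "dim (range (\<lambda>v. bracket x1 v + scale t (bracket y v))) \<le> 2" for t
      using rank_le [of "x1 + scale t y"] by (simp add: left.add left.scale)
  qed (use that ind ne in \<open>simp_all add: x3_def x5_def\<close>)
  have skewI: "bracket k y \<in> ?I" if "bracket y k \<in> ?I" for y k
    using span_neg [OF that] bracket_skew [of k y] by simp
  define zs where "zs = (if bracket x2 x4 \<in> ?I then [] else [bracket x2 x4])"
  have "independent (set zs \<union> {x3, x5})"
    using ind independent_insertI [of "bracket x2 x4" "{x3, x5}"] by (simp add: zs_def insert_commute)
  moreover have "x3 \<notin> set zs" "x5 \<notin> set zs" "distinct zs"
    using span_base [of x3 "{x3, x5}"] span_base [of x5 "{x3, x5}"] by (auto simp: zs_def)
  moreover have "\<exists>u v. z = bracket u v" if "z \<in> set zs" for z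
    using that by (auto simp: zs_def split: if_splits)
  ultimately obtain ms where
    bs: "ordered_basis ([x1, x2, x3, x4, x5] @ ms @ zs)" and ms: "\<And>m. m \<in> set ms \<Longrightarrow> bracket x1 m = 0"
    using ordered_basis_extending_kernel [OF class2 fin, of zs x1 x2 x4] ne range
    unfolding x3_def x5_def by metis
  define bs where "bs = [x1, x2, x3, x4, x5] @ ms @ zs"
  define Y where "Y i = bs ! (i - 1)" for i
  have len: "length bs = n"
    using length_ordered_basis [OF bs] n by (simp add: bs_def)
  then have n5: "5 \<le> n" by (simp add: bs_def)
  have basis: "indexed_basis n Y"
    using indexed_basis_nth [OF bs] len by (simp add: bs_def Y_def [abs_def])
  have Y: "Y 1 = x1" "Y (Suc 0) = x1" "Y 2 = x2" "Y 3 = x3" "Y 4 = x4" "Y 5 = x5"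
    by (simp_all add: Y_def bs_def)
  have central: "bracket y z = 0" "bracket z y = 0" if "z \<in> {x3, x5} \<union> set zs" for y z
  proof -
    have "\<exists>u v. z = bracket u v"
      using that by (auto simp: x3_def x5_def zs_def split: if_splits)
    then show "bracket y z = 0" using class2 by blast
    then show "bracket z y = 0" using bracket_skew [of z y] by simp
  qed
  have Y_kernel: "bracket x1 (Y i) = 0" if i: "i \<in> {1..n}" "i \<notin> {2, 4}" for i
  proof -
    have "i \<noteq> 0" "i \<noteq> 2" "i \<noteq> 4" using i by auto
    then consider "i = 1" | "i = 3" | "i = 5" | "6 \<le> i"
      by linarith
    then show ?thesis
    proof cases
      assume "6 \<le> i"
      then have "i - 1 = length [x1, x2, x3, x4, x5] + (i - 6)" by simp
      then have "Y i = (ms @ zs) ! (i - 6)"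
        unfolding Y_def bs_def by (simp only: nth_append_length_plus)
      moreover have "i - 6 < length (ms @ zs)"
        using i \<open>6 \<le> i\<close> len by (auto simp: bs_def)
      ultimately have "Y i \<in> set (ms @ zs)" by (metis nth_mem)
      then show ?thesis using ms central by auto
    qed (auto simp: Y alternating central)
  qed
  have first: "bracket (Y 1) (Y j) = mu0_table Y 1 j" if "1 < j" "j \<le> n" for j
    using Y_kernel [of j] that by (auto simp: mu0_table_def Y x3_def x5_def)
  have central_35: "bracket (Y i) (Y j) = 0" if "i \<in> {3, 5} \<or> j \<in> {3, 5}" for i j
    using that by (auto simp: Y central)
  \<comment> \<open>every pair of indices other than \<open>(2, 4)\<close> involves a vector of the kernel of \<open>ad x1\<close>\<close>
  have in_I: "bracket (Y i) (Y j) \<in> ?I"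
    if "2 \<le> i" "i < j" "j \<le> n" "(i, j) \<noteq> (2, 4) \<or> bracket x2 x4 \<in> ?I" for i j
  proof (cases "(i, j) = (2, 4)")
    case True
    then show ?thesis using that by (simp add: Y)
  next
    case False
    then have "i \<notin> {2, 4} \<or> j \<notin> {2, 4}" using that by auto
    then show ?thesis
      using Y_kernel [of i] Y_kernel [of j] kernel skewI that by auto
  qed
  have "\<forall>i j. \<exists>a b. bracket (Y i) (Y j) \<in> ?I \<longrightarrow> bracket (Y i) (Y j) = scale a x3 + scale b x5"
    by (auto simp: in_span_pair_iff)
  then obtain a3 a5 where
    coeff: "\<And>i j. bracket (Y i) (Y j) \<in> ?I \<Longrightarrow> bracket (Y i) (Y j) = scale (a3 i j) x3 + scale (a5 i j) x5"
    by metis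
  have skew: "skew_bilinear bracket"
    unfolding skew_bilinear_def using linear_right bracket_skew by blast
  show thesis
  proof (cases "bracket x2 x4 \<in> ?I")
    case True
    have "bracket (Y i) (Y j) = mu0_table Y i j + phi1_table a3 a5 Y i j"
      if "1 \<le> i" "i < j" "j \<le> n" for i j
    proof (cases "i = 1")
      case True
      then show ?thesis using first that by (simp add: phi1_table_def)
    next
      case False
      then have "2 \<le> i" using that by simp
      then show ?thesis
        using coeff [OF in_I [of i j]] central_35 [of i j] that True
        by (auto simp: mu0_table_def phi1_table_def Y)
    qed
    then have "skew_with_products n Y (\<lambda>i j. mu0_table Y i j + phi1_table a3 a5 Y i j) bracket"
      using skew by (simp add: skew_with_products_def)
    then show thesis by (intro that [OF basis n5]) blast
  next
    case False
    then have zs: "zs = [bracket x2 x4]" by (simp add: zs_def)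
    \<comment> \<open>keeps the index \<open>n\<close> of \<open>[x2, x4]\<close> apart from 3 and 5\<close>
    then have n6: "6 \<le> n" using len by (simp add: bs_def)
    have Yn: "Y n = bracket x2 x4"
      using zs len [symmetric] by (simp add: Y_def bs_def nth_append)
    have "bracket (Y i) (Y j) = mu0_table Y i j + phi2_table n a3 a5 Y i j"
      if ij: "1 \<le> i" "i < j" "j \<le> n" for i j
    proof (cases "i = 1")
      case True
      then show ?thesis using first ij by (simp add: phi2_table_def)
    next
      case False
      then have "2 \<le> i" using ij by simp
      consider "(i, j) = (2, 4)" | "(i, j) \<noteq> (2, 4)" "j = n" | "(i, j) \<noteq> (2, 4)" "j \<le> n - 1"
        using ij by linarith
      then show ?thesis
      proof cases
        case 1
        then show ?thesis by (simp add: mu0_table_def phi2_table_def Y Yn)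
      next
        case 2
        have "bracket (Y i) (Y n) = 0" unfolding Yn by (rule central) (simp add: zs)
        with 2 \<open>2 \<le> i\<close> n6 show ?thesis by (auto simp: mu0_table_def phi2_table_def)
      next
        case 3
        then show ?thesis
          using coeff [OF in_I [of i j]] central_35 [of i j] ij \<open>2 \<le> i\<close>
          by (auto simp: mu0_table_def phi2_table_def Y)
      qed
    qed
    then have "skew_with_products n Y (\<lambda>i j. mu0_table Y i j + phi2_table n a3 a5 Y i j) bracket"
      using skew by (simp add: skew_with_products_def)
    then show thesis by (intro that [OF basis n5]) blast
  qed
qed

end

lemma (in linear_space_iso) skew_with_products_image:
  assumes b: "V.skew_with_products n Y t b"
    and tu: "\<And>i j. 1 \<le> i \<Longrightarrow> i < j \<Longrightarrow> j \<le> n \<Longrightarrow> f (t i j) = u i j"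
    and X: "\<And>i. i \<in> {1..n} \<Longrightarrow> f (Y i) = X i"
  shows "W.skew_with_products n X u (\<lambda>x y. f (b (g x) (g y)))"
proof -
  have lin: "Vector_Spaces.linear s1 s1 (b v)" and skew: "b w v = - b v w"
    and prod: "1 \<le> i \<and> i < j \<and> j \<le> n \<Longrightarrow> b (Y i) (Y j) = t i j" for v w i j
    using b unfolding V.skew_with_products_def V.skew_bilinear_def by blast+
  have "Vector_Spaces.linear s2 s2 (\<lambda>y. f (b (g x) (g y)))" for x
    using lin [of "g x"] W.vector_space_axioms
    by (simp add: Vector_Spaces.linear_iff g.add g.scale f.add f.scale)
  moreover have "f (b (g y) (g x)) = - f (b (g x) (g y))" for x y
    by (simp only: skew [of "g y" "g x"] f.neg)
  moreover have "f (b (g (X i)) (g (X j))) = u i j" if "1 \<le> i \<and> i < j \<and> j \<le> n" for i j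
  proof -
    have "g (X i) = Y i" "g (X j) = Y j"
      using that X [of i] X [of j] gf [of "Y i"] gf [of "Y j"] by auto
    then show ?thesis using that prod [OF that] tu by simp
  qed
  ultimately show ?thesis
    unfolding W.skew_with_products_def W.skew_bilinear_def by blast
qed

theorem proposition7:
  fixes scale :: "'k::field_char_0 \<Rightarrow> 'g::ab_group_add \<Rightarrow> 'g"
    and bracket :: "'g \<Rightarrow> 'g \<Rightarrow> 'g"
    and X :: "nat \<Rightarrow> 'k ^ 'n"
  assumes basis: "linear_space.indexed_basis (*s) CARD('n) X"
    and lie: "lie_algebra scale bracket"
    and dim: "vector_space.dim scale (UNIV :: 'g set) = CARD('n)"
    and nilpotent: "lie_algebra.nilpotent scale bracket"
    and breadth: "lie_algebra.breadth scale bracket = 2"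
    and char_seq: "lie_algebra.char_seq scale bracket = seq_22 CARD('n)"
  shows "\<exists>\<mu> \<in> family_C1 X \<union> family_C2 X. lie_isomorphic scale bracket (*s) \<mu>"
proof -
  interpret L: lie_algebra scale bracket by (fact lie)
  interpret K: linear_space "(*s) :: 'k \<Rightarrow> 'k ^ 'n \<Rightarrow> 'k ^ 'n"
    by (simp add: linear_space_def vec.vector_space_axioms)
  have char: "(2 :: 'k) \<noteq> 0" "(3 :: 'k) \<noteq> 0" by simp_all
  obtain B where B: "L.independent B" "UNIV \<subseteq> L.span B" "card B = L.dim UNIV"
    using L.basis_exists [of UNIV] by metis
  have fin: "finite B" "L.span B = UNIV"
    using B dim by (auto intro: card_ge_0_finite)
  have class2: "bracket x (bracket y z) = 0" for x y z
    by (rule L.class_2_if_ad_square_eq_0 [OF char(2)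
          L.ad_square_eq_0_if_char_seq_22 [OF char(1) fin nilpotent char_seq]])
  obtain Y where Y: "L.indexed_basis CARD('n) Y" "5 \<le> CARD('n)"
    and products: "(\<exists>a3 a5. L.skew_with_products CARD('n) Y (\<lambda>i j. L.mu0_table Y i j + L.phi1_table a3 a5 Y i j) bracket) \<or>
      (\<exists>a3 a5. L.skew_with_products CARD('n) Y (\<lambda>i j. L.mu0_table Y i j + L.phi2_table CARD('n) a3 a5 Y i j) bracket)"
    by (rule L.normal_form_if_class_2_breadth_2 [OF char class2 fin breadth dim [symmetric]])
  obtain f g where "linear_space_iso scale (*s) f g" and fY: "\<And>i. i \<in> {1..CARD('n)} \<Longrightarrow> f (Y i) = X i"
    using indexed_bases_isomorphic [OF L.linear_space_axioms K.linear_space_axioms Y(1) basis] by blast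
  then interpret iso: linear_space_iso scale "(*s)" f g by simp
  define \<mu> where "\<mu> = (\<lambda>x y. f (bracket (g x) (g y)))"
  interpret iso: lie_algebra_iso scale bracket "(*s)" \<mu> f g
    unfolding \<mu>_def by (rule iso.lie_algebra_iso_transport [OF lie])
  have "\<exists>u v. bracket u v \<noteq> 0"
  proof (rule ccontr)
    assume "\<not> ?thesis"
    then have "L.dim (range (L.ad x)) = 0" for x
      using L.dim_le_card [of "{0}" "{}"] by (simp add: image_constant_conv)
    then show False using L.rank_2_if_breadth_2(2) [OF fin breadth] by simp
  qed
  then have "L.two_step_nilpotent" using L.two_step_nilpotentI [OF class2] by blast
  then have family_F: "\<mu> \<in> family_F"
    using iso.two_step_nilpotent_image iso.char_seq_image char_seq iso.W.lie_algebra_axioms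
    by (simp add: family_F_def)
  have fX: "f (Y 3) = X 3" "f (Y 5) = X 5" "f (Y CARD('n)) = X CARD('n)"
    using fY Y(2) by auto
  have mu0: "f (L.mu0_table Y i j) = K.mu0_table X i j" for i j
    by (simp add: L.mu0_table_def K.mu0_table_def fX iso.f.zero)
  have phi1: "f (L.phi1_table a3 a5 Y i j) = K.phi1_table a3 a5 X i j" for a3 a5 i j
    by (simp add: L.phi1_table_def K.phi1_table_def fX iso.f.zero iso.f.add iso.f.scale)
  have phi2: "f (L.phi2_table CARD('n) a3 a5 Y i j) = K.phi2_table CARD('n) a3 a5 X i j" for a3 a5 i j
    by (simp add: L.phi2_table_def K.phi2_table_def fX iso.f.zero iso.f.add iso.f.scale)
  note image = iso.skew_with_products_image [of "CARD('n)" Y _ bracket _ X, folded \<mu>_def]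
  from products have "\<mu> \<in> family_C1 X \<union> family_C2 X"
  proof (elim disjE exE)
    fix a3 a5
    assume "L.skew_with_products CARD('n) Y (\<lambda>i j. L.mu0_table Y i j + L.phi1_table a3 a5 Y i j) bracket"
    then have "K.skew_with_products CARD('n) X (\<lambda>i j. K.mu0_table X i j + K.phi1_table a3 a5 X i j) \<mu>"
      by (rule image) (simp_all add: iso.f.add mu0 phi1 fY)
    then obtain \<beta> \<phi> where "K.skew_with_products CARD('n) X (K.mu0_table X) \<beta>"
      "K.skew_with_products CARD('n) X (K.phi1_table a3 a5 X) \<phi>" "\<mu> = (\<lambda>x y. \<beta> x y + \<phi> x y)"
      by (rule K.skew_with_products_split [OF basis])
    then have "\<mu> \<in> family_C1 X"
      using family_F unfolding family_C1_def K.is_mu0_iff K.is_phi1_iff by blast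
    then show ?thesis by blast
  next
    fix a3 a5
    assume "L.skew_with_products CARD('n) Y (\<lambda>i j. L.mu0_table Y i j + L.phi2_table CARD('n) a3 a5 Y i j) bracket"
    then have "K.skew_with_products CARD('n) X (\<lambda>i j. K.mu0_table X i j + K.phi2_table CARD('n) a3 a5 X i j) \<mu>"
      by (rule image) (simp_all add: iso.f.add mu0 phi2 fY)
    then obtain \<beta> \<phi> where "K.skew_with_products CARD('n) X (K.mu0_table X) \<beta>"
      "K.skew_with_products CARD('n) X (K.phi2_table CARD('n) a3 a5 X) \<phi>" "\<mu> = (\<lambda>x y. \<beta> x y + \<phi> x y)"
      by (rule K.skew_with_products_split [OF basis])
    then have "\<mu> \<in> family_C2 X"
      using family_F unfolding family_C2_def K.is_mu0_iff K.is_phi2_iff by blast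
    then show ?thesis by blast
  qed
  then show ?thesis using iso.lie_isomorphic by blast
qed

end
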